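(* Let $W$ be the Cantor set and let $P=P(\infty)$ or $P=P(m,n)$ for some $(m,n)\in J$; let $\widetilde P=\widetilde{P(\infty)}$ if $P=P(\infty)$ and $\widetilde P=P$ if $P$ is finite. Then for each subset $I$ of $\widetilde{P}-\widetilde{P}_{\max}$ there is an open subset $A$ of $W$, unique up to homeomorphisms of $W$, such that (i) the closure subalgebra $\mathscr{C}$ of $2^W$ generated by $A$ is isomorphic to $\mathscr{E}(P)$; (ii) the atoms of $\mathscr{C}$, indexed via this isomorphism (the atom corresponding to $\{p\}$ being indexed by $p$), together with $A_\infty$ (indexed by $\bot$) in the case $P=P(\infty)$, form a complete trim $I$-isolated $\widetilde P$-partition of $W$.
   Context: A closure algebra is a Boolean algebra with an operator $x\mapsto\overline{x}$ satisfying $x\subseteq\overline x$, $\overline{\overline x}=\overline x$, $\overline{x\cup y}=\overline x\cup\overline y$, $\overline{0}=0$; for a topological space $W$, $2^W$ is a closure algebra with topological closure. For a poset $P$, $\mathscr{E}(P)$ is the closure subalgebra of $2^P$ generated by the lower subsets of $P$, with closure $Q\mapsto\{p\in P: p\le q \text{ for some } q\in Q\}$. $P(\infty)$ is the poset $\{p_k\mid k\ge0\}$ with $p_j>p_k$ iff $k\ge j+2$; $\widetilde{P(\infty)}=P(\infty)\cup\{\bot\}$ with the additional relations $p_k>\bot$ for all $k$. $J=\mathbb{N}\times\{0,2\}$ (with $0\in\mathbb N$); for $m\ge0$, $P(m,0)=\{p_0,\dots,p_m\}$ and $P(m,2)=P(m,0)\cup\{p_{m+2}\}$, with the order inherited from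 $P(\infty)$. For $A\subseteq W$, $A_\infty=W-\bigcup\{B: B$ an atom of the closure subalgebra generated by $A\}$. $\widetilde P_{\max}$ is the set of maximal elements of $\widetilde P$. Partition notions: for a poset $P$ and topological space $W$, a $P$-partition is a family $\{X_p\mid p\in P\}$ of pairwise disjoint non-empty subsets of $W$; complete if their union is $W$. For $Y\subseteq W$, $T(Y)=\{p: Y\cap X_p\ne\emptyset\}$; an open $A$ is $p$-trim ($t(A)=p$) if $T(A)=\{q: q\ge p\}$ (and, $W$ being a Stone space, compact), trim if $p$-trim for some $p$. $\widehat P$ is the set of $p$ for which a $p$-trim set exists. The partition is semi-trim if every point of $W$ has a neighbourhood base of trim sets; if $A$ open and $p\in T(A)\cap\widehat P$ then $A$ contains a $p$-trim subset; if $x\in X_p$ then $p=\sup\{t(A): A\text{ trim}, x\in A\}$; and every point with a neighbourhood base of $p$-trim sets lies in $X_p$. It is trim if moreover every $x\in X_p$ has a $p$-trim neighbourhood. It is $I$-isolated if $X_p$ has no isolated points for $p\notin I$, every point of $X_p$ is isolated in $X_p$ for $p\in I$, and $|X_p|=1$ for $p\in I$ minimal in the poset.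
   Formalization: The open subset A is required to be non-empty, in existence and in uniqueness, since for P = P(0,0) both A = W and the empty set satisfy (i) and (ii) but are not homeomorphic; for every other P the condition holds automatically. *)

theory Defs
  imports "HOL-Analysis.Analysis" "HOL-Library.Lub_Glb"
begin

section \<open>Closure algebras of sets\<close>

definition closure_algebra :: "'a set \<Rightarrow> ('a set \<Rightarrow> 'a set) \<Rightarrow> 'a set set \<Rightarrow> bool"
  where "closure_algebra \<Omega> c M \<longleftrightarrow> algebra \<Omega> M \<and>
     (\<forall>x\<in>M. c x \<in> M \<and> x \<subseteq> c x \<and> c (c x) = c x) \<and>
     (\<forall>x\<in>M. \<forall>y\<in>M. c (x \<union> y) = c x \<union> c y) \<and> c {} = {}"

definition closure_subalgebra :: "'a set \<Rightarrow> ('a set \<Rightarrow> 'a set) \<Rightarrow> 'a set set \<Rightarrow> bool"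
  where "closure_subalgebra \<Omega> c M \<longleftrightarrow> algebra \<Omega> M \<and> (\<forall>x\<in>M. c x \<in> M)"

text \<open>The closure subalgebra of \<open>2\<^sup>\<Omega>\<close> (with closure \<open>c\<close>) generated by \<open>G \<subseteq> Pow \<Omega>\<close>.\<close>

definition generated_subalgebra :: "'a set \<Rightarrow> ('a set \<Rightarrow> 'a set) \<Rightarrow> 'a set set \<Rightarrow> 'a set set"
  where "generated_subalgebra \<Omega> c G = (closure_subalgebra \<Omega> c) hull G"

definition closure_algebra_iso ::
  "'a set \<Rightarrow> ('a set \<Rightarrow> 'a set) \<Rightarrow> 'a set set \<Rightarrow>
   'b set \<Rightarrow> ('b set \<Rightarrow> 'b set) \<Rightarrow> 'b set set \<Rightarrow> ('a set \<Rightarrow> 'b set) \<Rightarrow> bool"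
  where "closure_algebra_iso \<Omega> c M \<Omega>' c' M' \<phi> \<longleftrightarrow> bij_betw \<phi> M M' \<and>
     (\<forall>x\<in>M. \<forall>y\<in>M. \<phi> (x \<union> y) = \<phi> x \<union> \<phi> y \<and> \<phi> (x \<inter> y) = \<phi> x \<inter> \<phi> y) \<and>
     (\<forall>x\<in>M. \<phi> (\<Omega> - x) = \<Omega>' - \<phi> x \<and> \<phi> (c x) = c' (\<phi> x))"

definition atom_of :: "'a set set \<Rightarrow> 'a set \<Rightarrow> bool"
  where "atom_of M B \<longleftrightarrow> B \<in> M \<and> B \<noteq> {} \<and> (\<forall>C\<in>M. C \<subseteq> B \<longrightarrow> C = {} \<or> C = B)"

lemma closure_algebra_Pow_topspace:
  "closure_algebra (topspace W) ((closure_of) W) (Pow (topspace W))"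
  unfolding closure_algebra_def
  by (simp add: algebra_Pow closure_of_subset closure_of_subset_topspace)

lemma closure_subalgebra_generated:
  assumes "closure_algebra \<Omega> c (Pow \<Omega>)" "G \<subseteq> Pow \<Omega>"
  shows "closure_subalgebra \<Omega> c (generated_subalgebra \<Omega> c G)"
proof -
  define S where "S = {t. closure_subalgebra \<Omega> c t \<and> G \<subseteq> t}"
  have P: "Pow \<Omega> \<in> S"
    using assms by (simp add: S_def closure_subalgebra_def closure_algebra_def)
  have S: "{} \<in> t" "x \<in> t \<Longrightarrow> \<Omega> - x \<in> t" "x \<in> t \<Longrightarrow> y \<in> t \<Longrightarrow> x \<union> y \<in> t"
    "x \<in> t \<Longrightarrow> c x \<in> t" if "t \<in> S" for t x y
    using that by (simp_all add: S_def closure_subalgebra_def algebra_iff_Un)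
  have "closure_subalgebra \<Omega> c (\<Inter>S)"
    unfolding closure_subalgebra_def algebra_iff_Un
    using Inter_lower[OF P] by (simp add: S)
  then show ?thesis
    by (simp add: generated_subalgebra_def hull_def S_def)
qed

lemma closure_algebra_subalgebra:
  assumes "closure_algebra \<Omega> c N" "closure_subalgebra \<Omega> c M" "M \<subseteq> N"
  shows "closure_algebra \<Omega> c M"
proof -
  have "x \<in> N" if "x \<in> M" for x
    using that assms(3) by (rule rev_subsetD)
  with assms(1,2) show ?thesis
    unfolding closure_algebra_def closure_subalgebra_def by simp
qed

definition open_generated :: "'a topology \<Rightarrow> 'a set \<Rightarrow> 'a set set"
  where "open_generated W A = generated_subalgebra (topspace W) ((closure_of) W) {A}"

definition A_infty :: "'a topology \<Rightarrow> 'a set \<Rightarrow> 'a set"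
  where "A_infty W A = topspace W - \<Union>{B. atom_of (open_generated W A) B}"


section \<open>Posets\<close>

text \<open>Here and below a poset is a subset of a type of class \<open>order\<close>, with the inherited order.\<close>

definition down :: "'p::order set \<Rightarrow> 'p set \<Rightarrow> 'p set"
  where "down P Q = {p \<in> P. \<exists>q\<in>Q. p \<le> q}"

definition lower_subsets :: "'p::order set \<Rightarrow> 'p set set"
  where "lower_subsets P = {L. L \<subseteq> P \<and> (\<forall>q\<in>L. \<forall>p\<in>P. p \<le> q \<longrightarrow> p \<in> L)}"

definition \<E> :: "'p::order set \<Rightarrow> 'p set set"
  where "\<E> P = generated_subalgebra P (down P) (lower_subsets P)"

lemma closure_algebra_Pow_down: "closure_algebra P (down P) (Pow P)"
proof -
  have "down P (down P x) = down P x" if "x \<in> Pow P" for x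
    using that unfolding down_def by (blast intro: order.trans order.refl)
  moreover have "x \<subseteq> down P x" "down P x \<in> Pow P" if "x \<in> Pow P" for x
    using that unfolding down_def by blast+
  moreover have "down P (x \<union> y) = down P x \<union> down P y" "down P {} = {}" for x y
    unfolding down_def by blast+
  ultimately show ?thesis
    unfolding closure_algebra_def by (simp add: algebra_Pow)
qed

definition maximal_elements :: "'p::order set \<Rightarrow> 'p set"
  where "maximal_elements P = {p \<in> P. \<not> (\<exists>q\<in>P. p < q)}"

definition minimal_elements :: "'p::order set \<Rightarrow> 'p set"
  where "minimal_elements P = {p \<in> P. \<not> (\<exists>q\<in>P. q < p)}"

datatype pt = Pt nat | Bot

instantiation pt :: order_bot
begin

definition bot_pt :: pt where "bot_pt = Bot"

fun less_pt :: "pt \<Rightarrow> pt \<Rightarrow> bool" where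
  "Pt k < Pt j \<longleftrightarrow> k \<ge> j + 2"
| "Bot < Pt j \<longleftrightarrow> True"
| "x < Bot \<longleftrightarrow> False"

definition less_eq_pt :: "pt \<Rightarrow> pt \<Rightarrow> bool"
  where "less_eq_pt x y \<longleftrightarrow> x < y \<or> x = y"

instance
proof
  fix x y z a :: pt
  show "x < y \<longleftrightarrow> x \<le> y \<and> \<not> y \<le> x"
    by (cases x; cases y) (auto simp: less_eq_pt_def)
  show "x \<le> x" by (simp add: less_eq_pt_def)
  show "x \<le> z" if "x \<le> y" "y \<le> z"
    using that by (cases x; cases y; cases z) (auto simp: less_eq_pt_def)
  show "x = y" if "x \<le> y" "y \<le> x"
    using that by (cases x; cases y) (auto simp: less_eq_pt_def)
  show "bot \<le> a"
    by (cases a) (auto simp: less_eq_pt_def bot_pt_def)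
qed

end

definition P_inf :: "pt set"
  where "P_inf = range Pt"

definition J :: "(nat \<times> nat) set"
  where "J = UNIV \<times> {0, 2}"

definition P_fin :: "nat \<Rightarrow> nat \<Rightarrow> pt set"
  where "P_fin m n = (if n = 0 then Pt ` {..m} else Pt ` {..m} \<union> {Pt (m + 2)})"

definition P_tilde :: "pt set \<Rightarrow> pt set"
  where "P_tilde P = (if P = P_inf then insert bot P_inf else P)"


section \<open>Trim partitions\<close>

text \<open>In a partition \<open>X :: 'p \<Rightarrow> 'a set\<close> of \<open>W\<close> indexed by \<open>P\<close>, only the values of \<open>X\<close> on \<open>P\<close> matter.\<close>

definition poset_partition :: "'a topology \<Rightarrow> 'p::order set \<Rightarrow> ('p \<Rightarrow> 'a set) \<Rightarrow> bool"
  where "poset_partition W P X \<longleftrightarrow>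
     (\<forall>p\<in>P. X p \<noteq> {} \<and> X p \<subseteq> topspace W) \<and> disjoint_family_on X P"

definition complete_partition :: "'a topology \<Rightarrow> 'p::order set \<Rightarrow> ('p \<Rightarrow> 'a set) \<Rightarrow> bool"
  where "complete_partition W P X \<longleftrightarrow> poset_partition W P X \<and> (\<Union>p\<in>P. X p) = topspace W"

definition type_set :: "'p::order set \<Rightarrow> ('p \<Rightarrow> 'a set) \<Rightarrow> 'a set \<Rightarrow> 'p set"
  where "type_set P X Y = {p \<in> P. Y \<inter> X p \<noteq> {}}"

text \<open>\<open>trim_at W P X p A\<close>: \<open>A\<close> is \<open>p\<close>-trim, i.e. \<open>A\<close> is trim with \<open>t(A) = p\<close>
  (\<open>p\<close> being determined by \<open>A\<close>, as the least element of \<open>type_set P X A\<close>).\<close>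

definition trim_at :: "'a topology \<Rightarrow> 'p::order set \<Rightarrow> ('p \<Rightarrow> 'a set) \<Rightarrow> 'p \<Rightarrow> 'a set \<Rightarrow> bool"
  where "trim_at W P X p A \<longleftrightarrow> p \<in> P \<and> openin W A \<and> compactin W A \<and>
     type_set P X A = {q \<in> P. q \<ge> p}"

definition trim_set :: "'a topology \<Rightarrow> 'p::order set \<Rightarrow> ('p \<Rightarrow> 'a set) \<Rightarrow> 'a set \<Rightarrow> bool"
  where "trim_set W P X A \<longleftrightarrow> (\<exists>p. trim_at W P X p A)"

definition P_hat :: "'a topology \<Rightarrow> 'p::order set \<Rightarrow> ('p \<Rightarrow> 'a set) \<Rightarrow> 'p set"
  where "P_hat W P X = {p \<in> P. \<exists>A. trim_at W P X p A}"

definition semi_trim_partition :: "'a topology \<Rightarrow> 'p::order set \<Rightarrow> ('p \<Rightarrow> 'a set) \<Rightarrow> bool"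
  where "semi_trim_partition W P X \<longleftrightarrow> poset_partition W P X \<and>
     neighbourhood_base_of (trim_set W P X) W \<and>
     (\<forall>A p. openin W A \<and> p \<in> type_set P X A \<inter> P_hat W P X \<longrightarrow> (\<exists>B\<subseteq>A. trim_at W P X p B)) \<and>
     (\<forall>p\<in>P. \<forall>x\<in>X p. isLub P {t. \<exists>A. trim_at W P X t A \<and> x \<in> A} p) \<and>
     (\<forall>p\<in>P. \<forall>x\<in>topspace W. neighbourhood_base_at x (trim_at W P X p) W \<longrightarrow> x \<in> X p)"

definition trim_partition :: "'a topology \<Rightarrow> 'p::order set \<Rightarrow> ('p \<Rightarrow> 'a set) \<Rightarrow> bool"
  where "trim_partition W P X \<longleftrightarrow> semi_trim_partition W P X \<and>
     (\<forall>p\<in>P. \<forall>x\<in>X p. \<exists>A. trim_at W P X p A \<and> x \<in> A)"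

definition isolated_point :: "'a topology \<Rightarrow> 'a set \<Rightarrow> 'a \<Rightarrow> bool"
  where "isolated_point W S x \<longleftrightarrow> x \<in> S \<and> (\<exists>U. openin W U \<and> U \<inter> S = {x})"

definition isolated_partition ::
  "'a topology \<Rightarrow> 'p::order set \<Rightarrow> 'p set \<Rightarrow> ('p \<Rightarrow> 'a set) \<Rightarrow> bool"
  where "isolated_partition W P I X \<longleftrightarrow>
     (\<forall>p\<in>P - I. \<not> (\<exists>x. isolated_point W (X p) x)) \<and>
     (\<forall>p\<in>P \<inter> I. \<forall>x\<in>X p. isolated_point W (X p) x) \<and>
     (\<forall>p\<in>minimal_elements P \<inter> I. card (X p) = 1)"


section \<open>Open sets realising a trim partition\<close>

definition cantor_space :: "(nat \<Rightarrow> bool) topology"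
  where "cantor_space = product_topology (\<lambda>_. discrete_topology UNIV) UNIV"

text \<open>The isomorphism \<open>\<phi>\<close> is taken from \<open>\<E> P\<close> to the closure subalgebra generated by \<open>A\<close>, so that
  \<open>\<phi> {p}\<close> is the atom indexed by \<open>p\<close>.\<close>

definition atom_family :: "'a topology \<Rightarrow> 'a set \<Rightarrow> (pt set \<Rightarrow> 'a set) \<Rightarrow> pt \<Rightarrow> 'a set"
  where "atom_family W A \<phi> p = (if p = bot then A_infty W A else \<phi> {p})"

text \<open>For \<open>P = {p\<^sub>0}\<close> this holds for \<open>A = topspace W\<close> and also for \<open>A = {}\<close>, since both
  generate the two-element algebra. It never holds for \<open>A = {}\<close> if \<open>P\<close> has two or more elements.\<close>

definition generates_trim_partition :: "'a topology \<Rightarrow> pt set \<Rightarrow> pt set \<Rightarrow> 'a set \<Rightarrow> bool"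
  where "generates_trim_partition W P I A \<longleftrightarrow> openin W A \<and>
     (\<exists>\<phi>. closure_algebra_iso P (down P) (\<E> P)
            (topspace W) ((closure_of) W) (open_generated W A) \<phi> \<and>
          complete_partition W (P_tilde P) (atom_family W A \<phi>) \<and>
          trim_partition W (P_tilde P) (atom_family W A \<phi>) \<and>
          isolated_partition W (P_tilde P) I (atom_family W A \<phi>))"

end

theory Submission
  imports Defs
begin

text \<open>A clopen set is described, up to homeomorphisms preserving the partition, by its type set together
  with the number of points it has in each piece \<open>X p\<close> where \<open>p \<in> I\<close> is minimal in that type set. If two
  clopen sets have the same description, then a splitting of one is matched by a splitting of the
  other, so a back-and-forth argument gives uniqueness of the partition. A partition of the
  required kind is obtained by reading points of the Cantor space as ascending walks in the poset and
  sorting them by the limit of the walk. Finally \<open>p\<^sub>0\<close> generates the finite/cofinite algebra \<open>\<E> P\<close>, and up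
  to an automorphism of \<open>P\<close> it is the only non-empty upper set that does.\<close>

section \<open>Homeomorphisms from back-and-forth relations\<close>

text \<open>Counting only in those pieces is enough because a piece \<open>X p\<close> meeting a
  clopen set \<open>A\<close> is finite there exactly if \<open>p\<close> lies in \<open>I\<close>
  and is minimal in the type set of \<open>A\<close>: compactness gives finiteness, and otherwise
  \<open>X p\<close> has no isolated points or accumulates at a point of a lower piece. An infinite
  piece supplies any finite number of points to both parts of a splitting, so it imposes no
  condition. Trimness enters through the single property \<open>base\<close> of
  \<open>trim_decomposition\<close>: a point of \<open>X p\<close> has arbitrarily small clopen
  neighbourhoods whose types are exactly the elements above \<open>p\<close>. In the construction,
  ascending walks stabilise even in the infinite poset, because going up lowers the index. If every
  move from \<open>p\<close> must leave \<open>p\<close>, a walk with limit \<open>p\<close> is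
  determined once it has reached \<open>p\<close>, and its point is isolated; a permitted move from
  \<open>p\<close> to itself destroys isolation. So \<open>I\<close> can be any set of elements that
  have something above them. The isomorphism in the statement is arbitrary, so uniqueness of the
  partition alone does not suffice: \<open>B\<close> might correspond to an upper set other than
  \<open>{Pt 0}\<close>.\<close>

abbreviation clopenin :: "'a topology \<Rightarrow> 'a set \<Rightarrow> bool"
  where "clopenin W A \<equiv> openin W A \<and> closedin W A"

text \<open>\<open>\<S> n\<close> stands for the paired blocks of the \<open>n\<close>-th partition.
  The relation becomes the graph of the homeomorphism and treats both spaces alike.\<close>

definition linked :: "(nat \<Rightarrow> ('a set \<times> 'b set) set) \<Rightarrow> 'a \<Rightarrow> 'b \<Rightarrow> bool"
  where "linked \<S> x y \<longleftrightarrow> (\<forall>n. \<exists>(A, B)\<in>\<S> n. x \<in> A \<and> y \<in> B)"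

lemma linkedD: "linked \<S> x y \<Longrightarrow> \<exists>A B. (A, B) \<in> \<S> n \<and> x \<in> A \<and> y \<in> B"
  unfolding linked_def by blast

text \<open>The blocks paired with those around \<open>x\<close> are nested, closed and non-empty,
  so by compactness they have a common point, and \<open>separate\<close> makes it unique. The last
  conclusion gives continuity here and small matched neighbourhoods in
  \<open>back_and_forth\<close>.\<close>

lemma linked_map:
  fixes \<S> :: "nat \<Rightarrow> ('a set \<times> 'b set) set"
  assumes V: "compact_space V"
    and blocks: "\<And>n A B. (A, B) \<in> \<S> n \<Longrightarrow> openin W A \<and> closedin V B \<and> (A \<noteq> {} \<longrightarrow> B \<noteq> {})"
    and cover: "\<And>n x. x \<in> topspace W \<Longrightarrow> \<exists>A B. (A, B) \<in> \<S> n \<and> x \<in> A"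
    and disjoint: "\<And>n x A B A' B'. (A, B) \<in> \<S> n \<Longrightarrow> (A', B') \<in> \<S> n \<Longrightarrow> x \<in> A \<Longrightarrow> x \<in> A' \<Longrightarrow>
      A = A' \<and> B = B'"
    and refine: "\<And>n A B. (A, B) \<in> \<S> (Suc n) \<Longrightarrow> \<exists>A' B'. (A', B') \<in> \<S> n \<and> A \<subseteq> A' \<and> B \<subseteq> B'"
    and separate: "\<And>y y'. \<lbrakk>\<forall>n. \<exists>(A, B)\<in>\<S> n. y \<in> B \<and> y' \<in> B\<rbrakk> \<Longrightarrow> y = y'"
  obtains h where "continuous_map W V h"
    "\<And>x y. x \<in> topspace W \<Longrightarrow> linked \<S> x y \<longleftrightarrow> y = h x"
    "\<And>x U. x \<in> topspace W \<Longrightarrow> openin V U \<Longrightarrow> h x \<in> U \<Longrightarrow>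
      \<exists>N. \<forall>n\<ge>N. \<forall>A B. (A, B) \<in> \<S> n \<longrightarrow> x \<in> A \<longrightarrow> B \<subseteq> U"
proof -
  have "\<exists>p. p \<in> \<S> n \<and> x \<in> fst p" if "x \<in> topspace W" for x n
    using cover[OF that, of n] by (metis fst_conv)
  then obtain b where b: "\<And>x n. x \<in> topspace W \<Longrightarrow> b x n \<in> \<S> n \<and> x \<in> fst (b x n)"
    by metis
  define A where "A x n = fst (b x n)" for x n
  define B where "B x n = snd (b x n)" for x n
  have AB: "(A x n, B x n) \<in> \<S> n" "x \<in> A x n" if "x \<in> topspace W" for x n
    using b[OF that] by (simp_all add: A_def B_def)
  have AB_unique: "A' = A x n \<and> B' = B x n"
    if "x \<in> topspace W" "(A', B') \<in> \<S> n" "x \<in> A'" for x n A' B'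
    using disjoint[OF that(2) AB(1)[OF that(1)] that(3) AB(2)[OF that(1)]] .
  have dec: "decseq (B x)" if x: "x \<in> topspace W" for x
  proof (rule decseq_SucI)
    fix n
    obtain A' B' where "(A', B') \<in> \<S> n" "A x (Suc n) \<subseteq> A'" "B x (Suc n) \<subseteq> B'"
      using refine[OF AB(1)[OF x]] by blast
    then show "B x (Suc n) \<subseteq> B x n"
      using AB_unique[OF x] AB(2)[OF x, of "Suc n"] by blast
  qed
  have B_closed: "closedin V (B x n)" and B_ne: "B x n \<noteq> {}" and A_open: "openin W (A x n)"
    if "x \<in> topspace W" for x n
    using blocks[OF AB(1)[OF that]] AB(2)[OF that] by blast+
  have "\<exists>y. \<forall>n. y \<in> B x n" if x: "x \<in> topspace W" for x
  proof -
    have "(\<Inter>n. B x n) \<noteq> {}"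
      by (rule compact_space_imp_nest[OF V B_closed[OF x] B_ne[OF x] dec[OF x]])
    then show ?thesis by auto
  qed
  then obtain h where h: "\<And>x n. x \<in> topspace W \<Longrightarrow> h x \<in> B x n"
    by metis
  have eq: "y = h x" if x: "x \<in> topspace W" and y: "\<And>n. y \<in> B x n" for x y
  proof (rule separate, rule allI)
    fix n
    show "\<exists>(A, B)\<in>\<S> n. y \<in> B \<and> h x \<in> B"
      using AB(1)[OF x] h[OF x] y by (intro bexI[of _ "(A x n, B x n)"]) simp_all
  qed
  have linked: "linked \<S> x y \<longleftrightarrow> y = h x" if x: "x \<in> topspace W" for x y
  proof
    assume "linked \<S> x y"
    have "y \<in> B x n" for n
    proof -
      obtain A' B' where "(A', B') \<in> \<S> n" "x \<in> A'" "y \<in> B'"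
        using linkedD[OF \<open>linked \<S> x y\<close>] by blast
      with AB_unique[OF x] show ?thesis by blast
    qed
    then show "y = h x" by (rule eq[OF x])
  next
    assume "y = h x"
    then show "linked \<S> x y"
      unfolding linked_def using AB[OF x] h[OF x]
      by (intro allI bexI[of _ "(A x n, B x n)" for n]) simp_all
  qed
  have small: "\<exists>N. B x N \<subseteq> U" if x: "x \<in> topspace W" and U: "openin V U" "h x \<in> U" for x U
  proof (rule ccontr)
    \<comment> \<open>The sets \<open>B x n - U\<close> would then be nested, closed and non-empty;
      a common point is \<open>h x\<close> by \<open>eq\<close>, yet \<open>h x\<close> lies in
      \<open>U\<close>.\<close>
    assume "\<not> ?thesis"
    then have "B x n - U \<noteq> {}" for n by blast
    moreover have "closedin V (B x n - U)" for n
      using B_closed[OF x] U(1) by (simp add: closedin_diff)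
    moreover have "decseq (\<lambda>n. B x n - U)"
      using dec[OF x] unfolding decseq_def by blast
    ultimately have "(\<Inter>n. B x n - U) \<noteq> {}"
      by (intro compact_space_imp_nest[OF V])
    then show False using eq[OF x] U(2) by blast
  qed
  show thesis
  proof
    show "continuous_map W V h"
      unfolding continuous_map
    proof (intro conjI allI impI)
      show "h ` topspace W \<subseteq> topspace V"
      proof (rule image_subsetI)
        fix x assume "x \<in> topspace W"
        then show "h x \<in> topspace V"
          using h[of x 0] closedin_subset[OF B_closed[of x 0]] by blast
      qed
      fix U assume U: "openin V U"
      have "\<exists>N. openin W (A x N) \<and> x \<in> A x N \<and> A x N \<subseteq> {x \<in> topspace W. h x \<in> U}"
        if x: "x \<in> topspace W" "h x \<in> U" for x
      proof -
        obtain N where N: "B x N \<subseteq> U" using small[OF x(1) U x(2)] ..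
        have "h x' \<in> U" if x': "x' \<in> A x N" "x' \<in> topspace W" for x'
          using AB_unique[OF x'(2) AB(1)[OF x(1)] x'(1)] h[OF x'(2), of N] N by blast
        then show ?thesis
          using AB(2)[OF x(1), of N] A_open[OF x(1), of N] openin_subset[OF A_open[OF x(1), of N]]
          by blast
      qed
      then show "openin W {x \<in> topspace W. h x \<in> U}"
        by (subst openin_subopen) blast
    qed
    show "\<And>x y. x \<in> topspace W \<Longrightarrow> linked \<S> x y \<longleftrightarrow> y = h x" by (rule linked)
    fix x U assume x: "x \<in> topspace W" and U: "openin V U" "h x \<in> U"
    obtain N where "B x N \<subseteq> U" using small[OF x U] ..
    then have "B' \<subseteq> U" if "n \<ge> N" "(A', B') \<in> \<S> n" "x \<in> A'" for n A' B'
      using AB_unique[OF x that(2,3)] decseqD[OF dec[OF x] that(1)] by blast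
    then show "\<exists>N. \<forall>n\<ge>N. \<forall>A B. (A, B) \<in> \<S> n \<longrightarrow> x \<in> A \<longrightarrow> B \<subseteq> U"
      by blast
  qed
qed

definition separating_clopens :: "'a topology \<Rightarrow> (nat \<Rightarrow> 'a set) \<Rightarrow> bool"
  where "separating_clopens W C \<longleftrightarrow> (\<forall>n. clopenin W (C n)) \<and>
     (\<forall>x\<in>topspace W. \<forall>y\<in>topspace W. (\<forall>n. x \<in> C n \<longleftrightarrow> y \<in> C n) \<longrightarrow> x = y)"

text \<open>Related pairs are split again and again, alternately by a prescribed set of the left and
  of the right family, until the blocks separate points on both sides. The second conclusion lets a
  caller deduce that \<open>h\<close> respects whatever small related pairs can detect.\<close>

theorem back_and_forth:
  fixes W :: "'a topology" and V :: "'b topology" and R :: "'a set \<Rightarrow> 'b set \<Rightarrow> bool"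
  assumes compact: "compact_space W" "compact_space V"
    and C: "separating_clopens W C" and D: "separating_clopens V D"
    and R_top: "R (topspace W) (topspace V)"
    and R_clopen: "\<And>A B. R A B \<Longrightarrow> clopenin W A \<and> clopenin V B"
    and R_empty: "\<And>A B. R A B \<Longrightarrow> A = {} \<longleftrightarrow> B = {}"
    and forward: "\<And>A B A'. R A B \<Longrightarrow> clopenin W A' \<Longrightarrow> A' \<subseteq> A \<Longrightarrow>
      \<exists>B'\<subseteq>B. R A' B' \<and> R (A - A') (B - B')"
    and backward: "\<And>A B B'. R A B \<Longrightarrow> clopenin V B' \<Longrightarrow> B' \<subseteq> B \<Longrightarrow>
      \<exists>A'\<subseteq>A. R A' B' \<and> R (A - A') (B - B')"
  obtains h where "homeomorphic_map W V h"
    "\<And>x U U'. x \<in> topspace W \<Longrightarrow> openin W U \<Longrightarrow> x \<in> U \<Longrightarrow> openin V U' \<Longrightarrow> h x \<in> U' \<Longrightarrow>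
      \<exists>A B. R A B \<and> x \<in> A \<and> A \<subseteq> U \<and> h x \<in> B \<and> B \<subseteq> U'"
proof -
  \<comment> \<open>Even stages \<open>2 * k\<close> cut the left block with \<open>C k\<close>, odd
    stages \<open>2 * k + 1\<close> the right block with \<open>D k\<close>, so every set of both
    families is used.\<close>
  define Q where "Q n A B A' B' \<longleftrightarrow> A' \<subseteq> A \<and> B' \<subseteq> B \<and> R A' B' \<and> R (A - A') (B - B') \<and>
      (if even n then A' = A \<inter> C (n div 2) else B' = B \<inter> D (n div 2))" for n A B A' B'
  have split: "\<exists>A' B'. Q n A B A' B'" if R: "R A B" for n A B
  proof (cases "even n")
    case True
    have "clopenin W (A \<inter> C (n div 2))"
      using C R_clopen[OF R] unfolding separating_clopens_def by blast
    from forward[OF R this] True show ?thesis by (auto simp: Q_def)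
  next
    case False
    have "clopenin V (B \<inter> D (n div 2))"
      using D R_clopen[OF R] unfolding separating_clopens_def by blast
    from backward[OF R this] False show ?thesis by (auto simp: Q_def)
  qed
  define a where "a n A B = (SOME A'. \<exists>B'. Q n A B A' B')" for n A B
  define b where "b n A B = (SOME B'. Q n A B (a n A B) B')" for n A B
  have Q: "Q n A B (a n A B) (b n A B)" if "R A B" for n A B
    unfolding b_def by (rule someI_ex, unfold a_def, rule someI_ex, rule split[OF that])
  have s: "a n A B \<subseteq> A" "b n A B \<subseteq> B" "R (a n A B) (b n A B)" "R (A - a n A B) (B - b n A B)"
      "even n \<Longrightarrow> a n A B = A \<inter> C (n div 2)" "odd n \<Longrightarrow> b n A B = B \<inter> D (n div 2)"
      if "R A B" for n A B
    using Q[OF that, of n] by (simp_all add: Q_def)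
  \<comment> \<open>Empty blocks are kept; this is harmless because \<open>R_empty\<close> makes
    both sides of a pair empty together.\<close>
  define \<S> where "\<S> = rec_nat {(topspace W, topspace V)}
      (\<lambda>n S. \<Union>(A, B)\<in>S. {(a n A B, b n A B), (A - a n A B, B - b n A B)})"
  have \<S>_0: "\<S> 0 = {(topspace W, topspace V)}" by (simp add: \<S>_def)
  have \<S>_Suc: "\<S> (Suc n) = (\<Union>(A, B)\<in>\<S> n. {(a n A B, b n A B), (A - a n A B, B - b n A B)})" for n
    by (simp add: \<S>_def)
  have \<S>_SucE': "\<exists>A0 B0. (A0, B0) \<in> \<S> n \<and> (A = a n A0 B0 \<and> B = b n A0 B0 \<or>
      A = A0 - a n A0 B0 \<and> B = B0 - b n A0 B0)" if AB: "(A, B) \<in> \<S> (Suc n)" for A B n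
    using AB unfolding \<S>_Suc by (simp add: split_beta) (metis prod.collapse)
  have \<S>_R: "R A B" if "(A, B) \<in> \<S> n" for n A B
    using that
  proof (induction n arbitrary: A B)
    case 0
    then show ?case by (simp add: \<S>_0 R_top)
  next
    case (Suc n)
    then obtain A0 B0 where 0: "(A0, B0) \<in> \<S> n" "A = a n A0 B0 \<and> B = b n A0 B0 \<or>
      A = A0 - a n A0 B0 \<and> B = B0 - b n A0 B0"
      using \<S>_SucE' by blast
    from s(3,4)[OF Suc.IH[OF 0(1)], of n] 0(2) show ?case by blast
  qed
  have \<S>_SucE: "\<exists>A0 B0. (A0, B0) \<in> \<S> n \<and> R A0 B0 \<and> (A = a n A0 B0 \<and> B = b n A0 B0 \<or>
      A = A0 - a n A0 B0 \<and> B = B0 - b n A0 B0)" if AB: "(A, B) \<in> \<S> (Suc n)" for A B n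
    using \<S>_SucE'[OF AB] \<S>_R by (metis (no_types))
  have \<S>_SucI: "(a n A B, b n A B) \<in> \<S> (Suc n)" "(A - a n A B, B - b n A B) \<in> \<S> (Suc n)"
    if "(A, B) \<in> \<S> n" for A B n
    unfolding \<S>_Suc using that by (auto intro!: bexI[of _ "(A, B)"])
  have cover: "(\<exists>A B. (A, B) \<in> \<S> n \<and> x \<in> A)" if "x \<in> topspace W" for n x
  proof (induction n)
    case 0
    then show ?case using that by (simp add: \<S>_0)
  next
    case (Suc n)
    then show ?case using \<S>_SucI by (metis DiffI)
  qed
  have cover': "(\<exists>A B. (A, B) \<in> \<S> n \<and> y \<in> B)" if "y \<in> topspace V" for n y
  proof (induction n)
    case 0
    then show ?case using that by (simp add: \<S>_0)
  next
    case (Suc n)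
    then show ?case using \<S>_SucI by (metis DiffI)
  qed
  \<comment> \<open>The disjunction lets one induction serve both uses of \<open>linked_map\<close>:
    a common point on either side identifies the two pairs.\<close>
  have disjoint: "A = A' \<and> B = B'"
    if "(A, B) \<in> \<S> n" "(A', B') \<in> \<S> n" "x \<in> A \<and> x \<in> A' \<or> y \<in> B \<and> y \<in> B'" for n x y A B A' B'
    using that
  proof (induction n arbitrary: A B A' B')
    case 0
    then show ?case by (simp add: \<S>_0)
  next
    case (Suc n)
    obtain A0 B0 where 0: "(A0, B0) \<in> \<S> n" "R A0 B0" "A = a n A0 B0 \<and> B = b n A0 B0 \<or>
      A = A0 - a n A0 B0 \<and> B = B0 - b n A0 B0"
      using \<S>_SucE[OF Suc.prems(1)] by blast
    obtain A1 B1 where 1: "(A1, B1) \<in> \<S> n" "R A1 B1" "A' = a n A1 B1 \<and> B' = b n A1 B1 \<or>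
      A' = A1 - a n A1 B1 \<and> B' = B1 - b n A1 B1"
      using \<S>_SucE[OF Suc.prems(2)] by blast
    have "A \<subseteq> A0" "B \<subseteq> B0" "A' \<subseteq> A1" "B' \<subseteq> B1"
      using 0(3) 1(3) s(1,2)[OF 0(2), of n] s(1,2)[OF 1(2), of n] by auto
    then have "A0 = A1 \<and> B0 = B1"
      using Suc.IH[OF 0(1) 1(1)] Suc.prems(3) by blast
    with 0(3) 1(3) Suc.prems(3) show ?case by blast
  qed
  have refine: "\<exists>A' B'. (A', B') \<in> \<S> n \<and> A \<subseteq> A' \<and> B \<subseteq> B'" if AB: "(A, B) \<in> \<S> (Suc n)" for n A B
  proof -
    obtain A0 B0 where 0: "(A0, B0) \<in> \<S> n" "R A0 B0" "A = a n A0 B0 \<and> B = b n A0 B0 \<or>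
      A = A0 - a n A0 B0 \<and> B = B0 - b n A0 B0"
      using \<S>_SucE[OF AB] by blast
    then have "A \<subseteq> A0" "B \<subseteq> B0" using s(1,2)[OF 0(2), of n] by auto
    with 0(1) show ?thesis by blast
  qed
  have sep: "x \<in> C n \<longleftrightarrow> x' \<in> C n" if AB: "(A, B) \<in> \<S> (Suc (2 * n))" "x \<in> A" "x' \<in> A" for n A B x x'
    
  proof -
    obtain A0 B0 where 0: "R A0 B0" "A = a (2 * n) A0 B0 \<or> A = A0 - a (2 * n) A0 B0"
      using \<S>_SucE[OF AB(1)] by blast
    have "a (2 * n) A0 B0 = A0 \<inter> C n" using s(5)[OF 0(1), of "2 * n"] by simp
    with 0(2) AB(2,3) show ?thesis by blast
  qed
  have sep': "y \<in> D n \<longleftrightarrow> y' \<in> D n" if AB: "(A, B) \<in> \<S> (Suc (Suc (2 * n)))" "y \<in> B" "y' \<in> B"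
    for n A B y y'
    
  proof -
    obtain A0 B0 where 0: "R A0 B0" "B = b (Suc (2 * n)) A0 B0 \<or> B = B0 - b (Suc (2 * n)) A0 B0"
      using \<S>_SucE[OF AB(1)] by blast
    have "b (Suc (2 * n)) A0 B0 = B0 \<inter> D n" using s(6)[OF 0(1), of "Suc (2 * n)"] by simp
    with 0(2) AB(2,3) show ?thesis by blast
  qed
  obtain h where h: "continuous_map W V h"
    "\<And>x y. x \<in> topspace W \<Longrightarrow> linked \<S> x y \<longleftrightarrow> y = h x"
    "\<And>x U. x \<in> topspace W \<Longrightarrow> openin V U \<Longrightarrow> h x \<in> U \<Longrightarrow>
      \<exists>N. \<forall>n\<ge>N. \<forall>A B. (A, B) \<in> \<S> n \<longrightarrow> x \<in> A \<longrightarrow> B \<subseteq> U"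
  proof (rule linked_map[OF compact(2), where \<S> = \<S> and W = W])
    show "openin W A \<and> closedin V B \<and> (A \<noteq> {} \<longrightarrow> B \<noteq> {})" if "(A, B) \<in> \<S> n" for n A B
      using R_clopen[OF \<S>_R[OF that]] R_empty[OF \<S>_R[OF that]] by blast
    show "y = y'" if y: "\<forall>n. \<exists>(A, B)\<in>\<S> n. y \<in> B \<and> y' \<in> B" for y y'
    proof -
      obtain A B where "(A, B) \<in> \<S> 0" "y \<in> B" "y' \<in> B" using y by blast
      then have "y \<in> topspace V" "y' \<in> topspace V" by (simp_all add: \<S>_0)
      moreover have "y \<in> D n \<longleftrightarrow> y' \<in> D n" for n
        using y[rule_format, of "Suc (Suc (2 * n))"] sep' by blast
      ultimately show ?thesis using D unfolding separating_clopens_def by blast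
    qed
  next
    show "\<exists>A B. (A, B) \<in> \<S> n \<and> x \<in> A" if "x \<in> topspace W" for n x
      by (rule cover[OF that])
    show "A = A' \<and> B = B'" if "(A, B) \<in> \<S> n" "(A', B') \<in> \<S> n" "x \<in> A" "x \<in> A'" for n x A B A' B'
      by (rule disjoint[OF that(1,2)]) (use that in blast)
    show "\<exists>A' B'. (A', B') \<in> \<S> n \<and> A \<subseteq> A' \<and> B \<subseteq> B'" if "(A, B) \<in> \<S> (Suc n)" for n A B
      by (rule refine[OF that])
  qed blast
  define \<S>' where "\<S>' n = prod.swap ` \<S> n" for n
  have \<S>': "(B, A) \<in> \<S>' n \<longleftrightarrow> (A, B) \<in> \<S> n" for A B n
    by (force simp: \<S>'_def)
  obtain g where g: "continuous_map V W g"
    "\<And>y x. y \<in> topspace V \<Longrightarrow> linked \<S>' y x \<longleftrightarrow> x = g y"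
    "\<And>y U. y \<in> topspace V \<Longrightarrow> openin W U \<Longrightarrow> g y \<in> U \<Longrightarrow>
      \<exists>N. \<forall>n\<ge>N. \<forall>B A. (B, A) \<in> \<S>' n \<longrightarrow> y \<in> B \<longrightarrow> A \<subseteq> U"
  proof (rule linked_map[OF compact(1), where \<S> = \<S>' and W = V])
    show "openin V B \<and> closedin W A \<and> (B \<noteq> {} \<longrightarrow> A \<noteq> {})" if "(B, A) \<in> \<S>' n" for n A B
      using R_clopen[OF \<S>_R] R_empty[OF \<S>_R] that by (simp add: \<S>')
    show "x = x'" if x: "\<forall>n. \<exists>(B, A)\<in>\<S>' n. x \<in> A \<and> x' \<in> A" for x x'
    proof -
      have x: "\<exists>A B. (A, B) \<in> \<S> n \<and> x \<in> A \<and> x' \<in> A" for n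
      proof -
        obtain B A where "(B, A) \<in> \<S>' n" "x \<in> A" "x' \<in> A" using x by blast
        then show ?thesis by (auto simp: \<S>')
      qed
      have "x \<in> topspace W" "x' \<in> topspace W" using x[of 0] by (simp_all add: \<S>_0)
      moreover have "x \<in> C n \<longleftrightarrow> x' \<in> C n" for n
        using x[of "Suc (2 * n)"] sep by blast
      ultimately show ?thesis using C unfolding separating_clopens_def by blast
    qed
  next
    show "\<exists>B A. (B, A) \<in> \<S>' n \<and> y \<in> B" if "y \<in> topspace V" for n y
      using cover'[OF that, of n] by (auto simp: \<S>')
    show "B = B' \<and> A = A'" if "(B, A) \<in> \<S>' n" "(B', A') \<in> \<S>' n" "y \<in> B" "y \<in> B'" for n y A B A' B'
      using disjoint[of A B n A' B'] that by (auto simp: \<S>')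
    show "\<exists>B' A'. (B', A') \<in> \<S>' n \<and> B \<subseteq> B' \<and> A \<subseteq> A'" if "(B, A) \<in> \<S>' (Suc n)" for n A B
      using refine[of A B n] that by (auto simp: \<S>')
  qed blast
  \<comment> \<open>Both \<open>h\<close> and \<open>g\<close> are read off one relation, which is
    why they are inverse to each other.\<close>
  have linked': "linked \<S>' y x \<longleftrightarrow> linked \<S> x y" for x y
    by (simp add: linked_def \<S>'_def split_beta conj_commute)
  have gh: "g (h x) = x" if x: "x \<in> topspace W" for x
  proof -
    have "h x \<in> topspace V" using h(1) x by (simp add: continuous_map_def Pi_iff)
    then show ?thesis using h(2)[OF x, of "h x"] g(2)[of "h x" x] linked'[of "h x" x] by simp
  qed
  have hg: "h (g y) = y" if y: "y \<in> topspace V" for y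
  proof -
    have "g y \<in> topspace W" using g(1) y by (simp add: continuous_map_def Pi_iff)
    then show ?thesis using g(2)[OF y, of "g y"] h(2)[of "g y" y] linked'[of y "g y"] by simp
  qed
  show thesis
  proof
    show "homeomorphic_map W V h"
      by (rule homeomorphic_maps_map[THEN iffD1, THEN conjunct1, of _ _ _ g])
        (simp add: homeomorphic_maps_def h(1) g(1) gh hg)
    fix x U U'
    assume x: "x \<in> topspace W" and U: "openin W U" "x \<in> U" and U': "openin V U'" "h x \<in> U'"
    have hx: "h x \<in> topspace V" using U' openin_subset by blast
    obtain N where N: "\<forall>n\<ge>N. \<forall>A B. (A, B) \<in> \<S> n \<longrightarrow> x \<in> A \<longrightarrow> B \<subseteq> U'"
      using h(3)[OF x U'] by blast
    obtain M where M: "\<forall>n\<ge>M. \<forall>B A. (B, A) \<in> \<S>' n \<longrightarrow> h x \<in> B \<longrightarrow> A \<subseteq> U"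
      using g(3)[OF hx U(1), unfolded gh[OF x], OF U(2)] by (elim exE)
    obtain A B where AB: "(A, B) \<in> \<S> (max N M)" "x \<in> A" "h x \<in> B"
      using linkedD[OF h(2)[OF x, THEN iffD2, OF refl], of "max N M"] by blast
    have "B \<subseteq> U'" using N[rule_format, OF max.cobounded1 AB(1,2)] .
    moreover have "A \<subseteq> U"
      using M[rule_format, OF max.cobounded2 _ AB(3)] AB(1) by (simp add: \<S>')
    ultimately show "\<exists>A B. R A B \<and> x \<in> A \<and> A \<subseteq> U \<and> h x \<in> B \<and> B \<subseteq> U'"
      using \<S>_R[OF AB(1)] AB(2,3) by blast
  qed
qed

section \<open>Splitting clopen sets of a trim partition\<close>

text \<open>Working form of a complete trim \<open>I\<close>-isolated partition of a compact
  Hausdorff space. The passage in both directions is made by the later results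
  \<open>trim_partition\<close> and \<open>trim_decompositionI\<close>.\<close>

locale trim_decomposition =
  fixes W :: "'a topology" and P I :: "'p::order set" and X :: "'p \<Rightarrow> 'a set"
  assumes compact: "compact_space W" and Hausdorff: "Hausdorff_space W"
    and complete: "complete_partition W P X"
    and base: "\<And>p x U. p \<in> P \<Longrightarrow> x \<in> X p \<Longrightarrow> openin W U \<Longrightarrow> x \<in> U \<Longrightarrow>
      \<exists>N. clopenin W N \<and> x \<in> N \<and> N \<subseteq> U \<and> type_set P X N = {q \<in> P. p \<le> q}"
    and isolated: "isolated_partition W P I X"
begin

lemma X_nonempty: "p \<in> P \<Longrightarrow> X p \<noteq> {}"
  and X_subset: "p \<in> P \<Longrightarrow> X p \<subseteq> topspace W"
  using complete by (simp_all add: complete_partition_def poset_partition_def)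

lemma X_unique: "p \<in> P \<Longrightarrow> q \<in> P \<Longrightarrow> x \<in> X p \<Longrightarrow> x \<in> X q \<Longrightarrow> p = q"
  using complete
  unfolding complete_partition_def poset_partition_def disjoint_family_on_def by blast

lemma X_cover:
  assumes "x \<in> topspace W"
  obtains p where "p \<in> P" "x \<in> X p"
  using assms complete unfolding complete_partition_def by blast

lemma openin_X_cover:
  assumes "openin W A" "x \<in> A"
  obtains p where "p \<in> P" "x \<in> X p"
  using assms openin_subset by (blast intro: X_cover)

lemma type_set_mono: "A \<subseteq> B \<Longrightarrow> type_set P X A \<subseteq> type_set P X B"
  unfolding type_set_def by blast

lemma type_setI: "p \<in> P \<Longrightarrow> x \<in> A \<Longrightarrow> x \<in> X p \<Longrightarrow> p \<in> type_set P X A"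
  unfolding type_set_def by blast

lemma type_setE:
  assumes "p \<in> type_set P X A"
  obtains x where "p \<in> P" "x \<in> A" "x \<in> X p"
  using assms unfolding type_set_def by blast

text \<open>Inside \<open>A\<close>, a point of type \<open>p\<close> has a neighbourhood that meets
  every piece above \<open>p\<close>.\<close>

lemma type_set_upward:
  assumes "openin W A" "p \<in> type_set P X A" "q \<in> P" "p \<le> q"
  shows "q \<in> type_set P X A"
proof -
  obtain x where x: "p \<in> P" "x \<in> A" "x \<in> X p" using assms(2) by (rule type_setE)
  obtain N where "N \<subseteq> A" "type_set P X N = {q \<in> P. p \<le> q}"
    using base[OF x(1,3) assms(1) x(2)] by blast
  then show ?thesis using type_set_mono[of N A] assms(3,4) by blast
qed

lemma type_set_empty_iff:
  assumes "A \<subseteq> topspace W"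
  shows "type_set P X A = {} \<longleftrightarrow> A = {}"
proof
  assume *: "type_set P X A = {}"
  show "A = {}"
  proof (rule ccontr)
    assume "A \<noteq> {}"
    then obtain x where "x \<in> A" "x \<in> topspace W" using assms by blast
    with * show False by (metis X_cover empty_iff type_setI)
  qed
qed (simp add: type_set_def)

lemma finite_subcover:
  assumes "closedin W A" "\<And>x. x \<in> A \<Longrightarrow> openin W (N x) \<and> x \<in> N x"
  obtains G where "finite G" "G \<subseteq> A" "A \<subseteq> \<Union>(N ` G)"
proof -
  have "compactin W A" using compact assms(1) by (rule closedin_compact_space)
  moreover have "Ball (N ` A) (openin W)" "A \<subseteq> \<Union>(N ` A)" using assms(2) by blast+
  ultimately obtain \<F> where "finite \<F>" "\<F> \<subseteq> N ` A" "A \<subseteq> \<Union>\<F>"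
    unfolding compactin_def by meson
  with that show thesis by (metis finite_subset_image)
qed

lemma clopen_separation:
  assumes "closedin W K" "closedin W L" "K \<inter> L = {}"
  obtains N where "clopenin W N" "K \<subseteq> N" "N \<inter> L = {}"
proof -
  have "\<exists>N. clopenin W N \<and> x \<in> N \<and> N \<inter> L = {}" if x: "x \<in> K" for x
  proof -
    have xW: "x \<in> topspace W" using x assms(1) closedin_subset by blast
    then obtain p where p: "p \<in> P" "x \<in> X p" by (rule X_cover)
    have "openin W (topspace W - L)" using assms(2) by blast
    moreover have "x \<in> topspace W - L" using x xW assms(3) by blast
    ultimately show ?thesis using base[OF p, of "topspace W - L"] by blast
  qed
  then obtain N where N: "clopenin W (N x)" "x \<in> N x" "N x \<inter> L = {}" if "x \<in> K" for x
    by metis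
  obtain G where G: "finite G" "G \<subseteq> K" "K \<subseteq> \<Union>(N ` G)"
    using finite_subcover[OF assms(1), of N] N by blast
  show thesis
  proof
    show "clopenin W (\<Union>(N ` G))"
      using N G(1,2) by (intro conjI openin_Union closedin_Union) auto
    show "K \<subseteq> \<Union>(N ` G)" by (rule G(3))
    show "\<Union>(N ` G) \<inter> L = {}" using N(3) G(2) by blast
  qed
qed

text \<open>Finitely many trim neighbourhoods cover \<open>A\<close>, and the types of their centres
  generate the type set.\<close>

lemma type_set_finitely_generated:
  assumes "clopenin W A"
  obtains G where "finite G" "G \<subseteq> type_set P X A" "\<And>q. q \<in> type_set P X A \<Longrightarrow> \<exists>p\<in>G. p \<le> q"
proof -
  have "\<exists>p N. p \<in> type_set P X A \<and> openin W N \<and> x \<in> N \<and> (\<forall>q\<in>type_set P X N. p \<le> q)"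
    if x: "x \<in> A" for x
  proof -
    have "x \<in> topspace W" using x assms openin_subset by blast
    then obtain p where p: "p \<in> P" "x \<in> X p" by (rule X_cover)
    then show ?thesis using base[OF p, of A] assms type_setI[OF p(1) x p(2)] x by blast
  qed
  then obtain t N where tN: "t x \<in> type_set P X A" "openin W (N x)" "x \<in> N x"
      "\<forall>q\<in>type_set P X (N x). t x \<le> q" if "x \<in> A" for x
    by metis
  obtain G where G: "finite G" "G \<subseteq> A" "A \<subseteq> \<Union>(N ` G)"
    using finite_subcover[of A N] tN(2,3) assms by blast
  show thesis
  proof
    show "finite (t ` G)" using G(1) by simp
    show "t ` G \<subseteq> type_set P X A" using G(2) tN(1) by blast
    fix q assume "q \<in> type_set P X A"
    then obtain x where x: "q \<in> P" "x \<in> A" "x \<in> X q" by (rule type_setE)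
    then obtain g where g: "g \<in> G" "x \<in> N g" using G(3) by blast
    then have "t g \<le> q" using tN(4)[of g] G(2) type_setI[OF x(1) g(2) x(3)] by blast
    with g(1) show "\<exists>p\<in>t ` G. p \<le> q" by blast
  qed
qed

text \<open>The poset itself is not assumed well-founded; minimal types exist because compactness
  provides finitely many generators.\<close>

lemma
  assumes "clopenin W A"
  shows finite_minimal_types: "finite (minimal_elements (type_set P X A))"
    and minimal_type_below:
      "q \<in> type_set P X A \<Longrightarrow> \<exists>p\<in>minimal_elements (type_set P X A). p \<le> q"
proof -
  obtain G where G: "finite G" "G \<subseteq> type_set P X A" "\<And>q. q \<in> type_set P X A \<Longrightarrow> \<exists>p\<in>G. p \<le> q"
    using assms by (rule type_set_finitely_generated) blast
  have "minimal_elements (type_set P X A) \<subseteq> G"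
  proof
    fix q assume q: "q \<in> minimal_elements (type_set P X A)"
    then obtain p where "p \<in> G" "p \<le> q" using G(3)[of q] by (auto simp: minimal_elements_def)
    with q G(2) show "q \<in> G" unfolding minimal_elements_def by (auto simp: order.strict_iff_order)
  qed
  then show "finite (minimal_elements (type_set P X A))" using G(1) by (rule finite_subset)
  assume "q \<in> type_set P X A"
  then obtain p where "p \<in> G" "p \<le> q" using G(3) by blast
  then obtain m where m: "m \<in> G" "m \<le> p" "\<And>b. b \<in> G \<Longrightarrow> b \<le> m \<Longrightarrow> m = b"
    using finite_has_minimal2[OF G(1)] by blast
  have "m \<in> minimal_elements (type_set P X A)"
    unfolding minimal_elements_def
  proof (intro CollectI conjI notI)
    show "m \<in> type_set P X A" using m(1) G(2) by blast
    assume "\<exists>r\<in>type_set P X A. r < m"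
    then obtain r b where "r < m" "b \<in> G" "b \<le> r" using G(3) by blast
    then show False using m(3)[of b] by force
  qed
  then show "\<exists>p\<in>minimal_elements (type_set P X A). p \<le> q"
    using m(2) \<open>p \<le> q\<close> by (meson order.trans)
qed

text \<open>Every point of \<open>A\<close> has a neighbourhood with at most one point of
  \<open>X p\<close>: a point of \<open>X p\<close> by isolation, any other because its type is not
  below the minimal \<open>p\<close>, so that a trim neighbourhood misses \<open>X p\<close>.
  Compactness does the rest.\<close>

lemma finite_minimal_isolated:
  assumes A: "clopenin W A" and p: "p \<in> minimal_elements (type_set P X A)" "p \<in> I"
  shows "finite (A \<inter> X p)"
proof -
  have pT: "p \<in> P" "p \<in> type_set P X A" using p(1) by (auto simp: minimal_elements_def type_set_def)
  have "\<exists>N. openin W N \<and> x \<in> N \<and> N \<inter> X p \<subseteq> {x}" if x: "x \<in> A" for x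
  proof (cases "x \<in> X p")
    case True
    then have "isolated_point W (X p) x"
      using isolated pT(1) p(2) unfolding isolated_partition_def by blast
    then obtain U where "openin W U" "U \<inter> X p = {x}" unfolding isolated_point_def by blast
    then show ?thesis by blast
  next
    case False
    have "x \<in> topspace W" using x A openin_subset by blast
    then obtain q where q: "q \<in> P" "x \<in> X q" by (rule X_cover)
    then obtain N where N: "openin W N" "x \<in> N" "type_set P X N = {r \<in> P. q \<le> r}"
      using base[OF q, of A] A x by blast
    have "\<not> q \<le> p"
      using p(1) type_setI[OF q(1) x q(2)] False q(2)
      unfolding minimal_elements_def by (auto simp: order.strict_iff_order)
    then have "N \<inter> X p = {}" using N(3) pT(1) by (auto simp: type_set_def)
    then show ?thesis using N by blast
  qed
  then obtain N where N: "openin W (N x)" "x \<in> N x" "N x \<inter> X p \<subseteq> {x}" if "x \<in> A" for x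
    by metis
  obtain G where G: "finite G" "G \<subseteq> A" "A \<subseteq> \<Union>(N ` G)"
    using finite_subcover[of A N] N A by blast
  have "A \<inter> X p \<subseteq> G" using G N(3) by blast
  then show ?thesis using G(1) by (rule finite_subset)
qed

text \<open>Were the set finite, removing all but one of its points from \<open>A\<close> would
  leave an open set isolating that point in \<open>X p\<close>.\<close>

lemma infinite_not_isolated:
  assumes A: "openin W A" and p: "p \<in> type_set P X A" "p \<notin> I"
  shows "infinite (A \<inter> X p)"
proof
  assume fin: "finite (A \<inter> X p)"
  obtain x where x: "p \<in> P" "x \<in> A" "x \<in> X p" using p(1) by (rule type_setE)
  have "closedin W (A \<inter> X p - {x})"
    using Hausdorff X_subset[OF x(1)] fin by (intro closedin_Hausdorff_finite) auto
  then have "openin W (A - (A \<inter> X p - {x}))" using A by (rule openin_diff[rotated])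
  moreover have "(A - (A \<inter> X p - {x})) \<inter> X p = {x}" using x by blast
  ultimately have "isolated_point W (X p) x" unfolding isolated_point_def using x(3) by blast
  then show False using isolated x(1) p(2) unfolding isolated_partition_def by blast
qed

text \<open>A finite set is closed, so a point of the lower piece would have a trim neighbourhood
  avoiding \<open>X p\<close>, although such a neighbourhood meets all higher pieces.\<close>

lemma infinite_not_minimal:
  assumes A: "openin W A" and q: "q \<in> type_set P X A" "q < p" "p \<in> P"
  shows "infinite (A \<inter> X p)"
proof
  assume fin: "finite (A \<inter> X p)"
  obtain y where y: "q \<in> P" "y \<in> A" "y \<in> X q" using q(1) by (rule type_setE)
  have "closedin W (A \<inter> X p)"
    using Hausdorff X_subset[OF q(3)] fin by (intro closedin_Hausdorff_finite) auto
  then have "openin W (A - (A \<inter> X p))" using A by (rule openin_diff[rotated])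
  moreover have "y \<in> A - (A \<inter> X p)" using y X_unique[OF y(1) q(3)] q(2) by auto
  ultimately obtain N where N: "N \<subseteq> A - (A \<inter> X p)" "type_set P X N = {r \<in> P. q \<le> r}"
    using base[OF y(1,3), of "A - (A \<inter> X p)"] by blast
  have "p \<in> type_set P X N" using N(2) q(2,3) by simp
  then show False using N(1) by (auto simp: type_set_def)
qed

end

text \<open>Covers both kinds of piece at once: a finite one is divided completely, an infinite one
  only supplies finitely many points to each half.\<close>

lemma disjoint_subsets_with_card:
  assumes "finite S \<Longrightarrow> card S = m + n"
  obtains M N where "M \<subseteq> S" "N \<subseteq> S" "M \<inter> N = {}" "finite M" "finite N" "card M = m" "card N = n"
    "finite S \<longrightarrow> S = M \<union> N"
proof -
  obtain T where T: "T \<subseteq> S" "finite T" "card T = m + n" "finite S \<Longrightarrow> T = S"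
    using assms infinite_arbitrarily_large[of S "m + n"] by (cases "finite S") auto
  obtain M where M: "M \<subseteq> T" "card M = m" "finite M"
    using obtain_subset_with_card_n[of m T] T(3) by auto
  show thesis
    by (rule that[of M "T - M"]) (use T M in \<open>auto simp: card_Diff_subset\<close>)
qed

text \<open>For clopen sets of trim decompositions the cardinalities compared are finite by
  \<open>finite_minimal_isolated\<close>, so the value of \<open>card\<close> on infinite sets does
  not interfere.\<close>

definition matched ::
    "'p::order set \<Rightarrow> 'p set \<Rightarrow> ('p \<Rightarrow> 'a set) \<Rightarrow> ('p \<Rightarrow> 'b set) \<Rightarrow> 'a set \<Rightarrow> 'b set \<Rightarrow> bool"
  where "matched P I X Y A B \<longleftrightarrow> type_set P X A = type_set P Y B \<and>
    (\<forall>p\<in>minimal_elements (type_set P X A) \<inter> I. card (A \<inter> X p) = card (B \<inter> Y p))"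

lemma matched_sym: "matched P I X Y A B \<longleftrightarrow> matched P I Y X B A"
  unfolding matched_def by auto

text \<open>In the proof, \<open>Z i\<close> is a finite set of points that have to go to the \<open>i\<close>-th half of \<open>B\<close>, and \<open>G i\<close> is
  the set of points that may go there. Both \<open>G i\<close> are open and they cover \<open>B\<close>, so a clopen set
  separating their complements splits \<open>B\<close>.\<close>

lemma matched_split:
  assumes X: "trim_decomposition W P I X" and Y: "trim_decomposition V P I Y"
    and A: "clopenin W A" and B: "clopenin V B" and AB: "matched P I X Y A B"
    and A': "clopenin W A'" "A' \<subseteq> A"
  obtains B' where "B' \<subseteq> B" "clopenin V B'" "matched P I X Y A' B'" "matched P I X Y (A - A') (B - B')"
proof -
  interpret X: trim_decomposition W P I X by (rule X)
  interpret Y: trim_decomposition V P I Y by (rule Y)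
  define H where "H i = (if i then A' else A - A')" for i
  define F where "F i = minimal_elements (type_set P X (H i))" for i
  \<comment> \<open>How many points of piece \<open>p\<close> to reserve for half \<open>i\<close>
    of \<open>B\<close>: the exact count where \<open>matched\<close> asks for one, a single witness
    for every other minimal type of the half, and none for types that are not minimal there.\<close>
  define n where "n i p = (if p \<in> F i then if p \<in> I then card (H i \<inter> X p) else 1 else 0)" for i p
  let ?M = "minimal_elements (type_set P X A)"
  have TAB: "type_set P X A = type_set P Y B"
    and cardAB: "\<And>p. p \<in> ?M \<Longrightarrow> p \<in> I \<Longrightarrow> card (A \<inter> X p) = card (B \<inter> Y p)"
    using AB by (auto simp: matched_def)
  have H: "clopenin W (H i)" "H i \<subseteq> A" for i
    using A A' by (auto simp: H_def)
  have H_types: "type_set P X (H i) \<subseteq> type_set P X A" for i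
    by (rule X.type_set_mono[OF H(2)])
  have H_cover: "\<exists>i. p \<in> type_set P X (H i)" if p: "p \<in> type_set P X A" for p
  proof -
    obtain x where "p \<in> P" "x \<in> A" "x \<in> X p" using p by (rule X.type_setE)
    then have "p \<in> type_set P X (H (x \<in> A'))" by (intro X.type_setI) (auto simp: H_def)
    then show ?thesis by blast
  qed
  have F_types: "p \<in> P" "p \<in> type_set P X (H i)" "p \<in> type_set P X A" if "p \<in> F i" for p i
    using that H_types[of i] by (auto simp: F_def minimal_elements_def type_set_def)
  have M_F: "p \<in> F i" if "p \<in> ?M" "p \<in> type_set P X (H i)" for p i
    using that H_types[of i] unfolding F_def minimal_elements_def by blast
  have n_pos: "n i p > 0" if p: "p \<in> F i" for i p
  proof (cases "p \<in> I")
    case True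
    have "finite (H i \<inter> X p)"
      using X.finite_minimal_isolated[OF H(1)] p True unfolding F_def by blast
    moreover have "H i \<inter> X p \<noteq> {}" using F_types(2)[OF p] by (simp add: type_set_def)
    ultimately show ?thesis using p True by (simp add: n_def card_gt_0_iff)
  qed (simp add: n_def p)
  have n_sum: "card (B \<inter> Y p) = n True p + n False p" if p: "p \<in> ?M" "p \<in> I" for p
  proof -
    have "n i p = card (H i \<inter> X p)" for i
    proof (cases "p \<in> type_set P X (H i)")
      case True
      then show ?thesis using M_F[OF p(1)] p(2) by (simp add: n_def)
    next
      case False
      moreover have "p \<in> P" using p(1) by (simp add: minimal_elements_def type_set_def)
      ultimately show ?thesis using F_types(2) by (auto simp: n_def type_set_def)
    qed
    moreover have "card (A \<inter> X p) = card (H True \<inter> X p) + card (H False \<inter> X p)"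
    proof -
      have "finite (A \<inter> X p)" by (rule X.finite_minimal_isolated[OF A p])
      moreover have "A \<inter> X p = (H True \<inter> X p) \<union> (H False \<inter> X p)" using A'(2) by (auto simp: H_def)
      moreover have "(H True \<inter> X p) \<inter> (H False \<inter> X p) = {}" by (auto simp: H_def)
      ultimately show ?thesis by (metis card_Un_disjoint finite_Un)
    qed
    ultimately show ?thesis using cardAB[OF p] by simp
  qed
  define Q where "Q p S \<longleftrightarrow>
      (\<forall>i. S i \<subseteq> B \<inter> Y p \<and> finite (S i) \<and> card (S i) = n i p) \<and> S True \<inter> S False = {} \<and>
      (p \<in> ?M \<inter> I \<longrightarrow> B \<inter> Y p = S True \<union> S False)" for p S
  have "\<exists>S. Q p S" if p: "p \<in> type_set P X A" for p
  proof -
    \<comment> \<open>Prescribed sizes could fail to add up only in a finite piece, and a finite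
      piece is one in which the points are counted.\<close>
    have fin: "p \<in> ?M \<inter> I" if "finite (B \<inter> Y p)"
    proof (rule ccontr)
      assume "p \<notin> ?M \<inter> I"
      then consider "p \<notin> I" | q where "q \<in> type_set P Y B" "q < p"
        using p TAB unfolding minimal_elements_def by blast
      then show False
      proof cases
        case 1
        then show False using Y.infinite_not_isolated[of B p] B p TAB that by simp
      next
        case 2
        moreover have "p \<in> P" using p by (simp add: type_set_def)
        ultimately show False using Y.infinite_not_minimal[of B q p] B that by simp
      qed
    qed
    then have "card (B \<inter> Y p) = n True p + n False p" if "finite (B \<inter> Y p)"
      using n_sum that by blast
    then obtain M N where MN: "M \<subseteq> B \<inter> Y p" "N \<subseteq> B \<inter> Y p" "M \<inter> N = {}" "finite M" "finite N"
      "card M = n True p" "card N = n False p" "finite (B \<inter> Y p) \<longrightarrow> B \<inter> Y p = M \<union> N"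
      by (rule disjoint_subsets_with_card)
    have "finite (B \<inter> Y p)" if "p \<in> ?M \<inter> I"
      by (rule Y.finite_minimal_isolated[OF B]) (use that TAB in auto)
    then show ?thesis
      unfolding Q_def using MN by (intro exI[of _ "\<lambda>i. if i then M else N"]) auto
  qed
  then obtain S where "\<And>p. p \<in> type_set P X A \<Longrightarrow> Q p (S p)"
    by metis
  then have S: "S p i \<subseteq> B \<inter> Y p" "finite (S p i)" "card (S p i) = n i p"
      "S p True \<inter> S p False = {}" "p \<in> ?M \<inter> I \<Longrightarrow> B \<inter> Y p = S p True \<union> S p False"
    if "p \<in> type_set P X A" for p i
    using that unfolding Q_def by simp_all
  define Z where "Z i = (\<Union>p\<in>F i. S p i)" for i
  have Z_sub: "Z i \<subseteq> B" for i using S(1) F_types(3) unfolding Z_def by blast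
  have Z_type: "p \<in> F i \<and> z \<in> S p i" if "z \<in> Z i" "p \<in> P" "z \<in> Y p" for z p i
  proof -
    obtain q where q: "q \<in> F i" "z \<in> S q i" using \<open>z \<in> Z i\<close> unfolding Z_def by blast
    then have "z \<in> Y q" using S(1)[OF F_types(3)[OF q(1)]] by blast
    then have "q = p" using Y.X_unique F_types(1)[OF q(1)] that(2,3) by blast
    with q show ?thesis by blast
  qed
  have Z_disjoint: "z \<notin> Z (\<not> i)" if zZ: "z \<in> Z i" for z i
  proof
    assume z': "z \<in> Z (\<not> i)"
    obtain p where p: "p \<in> P" "z \<in> Y p"
      using Y.openin_X_cover[of B z] zZ Z_sub[of i] B by blast
    have "z \<in> S p i" "z \<in> S p (\<not> i)" "p \<in> type_set P X A"
      using Z_type[OF zZ p] Z_type[OF z' p] F_types(3) by blast+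
    then show False using S(4)[of p] by (cases i) auto
  qed
  have Z_finite: "finite (Z i)" for i
    unfolding Z_def
  proof (rule finite_UN_I)
    show "finite (F i)" unfolding F_def by (rule X.finite_minimal_types[OF H(1)])
  qed (rule S(2)[OF F_types(3)])
  have Z_M: "z \<in> Z True \<union> Z False" if p: "p \<in> ?M" "p \<in> I" and z: "z \<in> B" "z \<in> Y p" for p z
  proof -
    have pA: "p \<in> type_set P X A" using p(1) by (simp add: minimal_elements_def)
    then obtain i where i: "z \<in> S p i" using S(5) p z by blast
    then have "card (S p i) \<noteq> 0" using S(2)[OF pA, of i] by auto
    then have "p \<in> F i" using S(3)[OF pA, of i] by (auto simp: n_def split: if_splits)
    with i have "z \<in> Z i" unfolding Z_def by blast
    then show ?thesis by (cases i) simp_all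
  qed
  \<comment> \<open>The clause for \<open>F i \<inter> I\<close> keeps the counts exact: a counted
    piece may enter the half only through its reserved points. The quantifier over \<open>p\<close>
    merely refers to the piece containing \<open>z\<close>.\<close>
  define G where "G i = {z \<in> B. \<forall>p\<in>P. z \<in> Y p \<longrightarrow>
      p \<in> type_set P X (H i) \<and> (p \<in> F i \<inter> I \<longrightarrow> z \<in> Z i)} - Z (\<not> i)" for i
  have G_open: "openin V (G i)" for i
  proof (subst openin_subopen, intro ballI)
    fix z assume z: "z \<in> G i"
    then have zB: "z \<in> B" and zZ: "z \<notin> Z (\<not> i)" by (auto simp: G_def)
    then obtain p where p: "p \<in> P" "z \<in> Y p"
      using Y.openin_X_cover[of B z] B by blast
    have pH: "p \<in> type_set P X (H i)" and pZ: "p \<in> F i \<inter> I \<Longrightarrow> z \<in> Z i"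
      using z p by (auto simp: G_def)
    \<comment> \<open>For \<open>p \<in> I\<close> this isolates \<open>z\<close> in its piece. All
      other points of a \<open>p\<close>-trim neighbourhood inside \<open>U\<close> then have types
      strictly above \<open>p\<close>, which are not minimal in \<open>H i\<close> and hence not
      counted.\<close>
    obtain U where U: "openin V U" "z \<in> U" "p \<in> I \<Longrightarrow> U \<inter> Y p \<subseteq> {z}"
    proof (cases "p \<in> I")
      case True
      then have "isolated_point V (Y p) z"
        using Y.isolated p unfolding isolated_partition_def by blast
      then obtain U where "openin V U" "U \<inter> Y p = {z}" unfolding isolated_point_def by blast
      then show thesis using that[of U] by blast
    next
      case False
      then show thesis using that[of B] B zB by blast
    qed
    have "closedin V (Z (\<not> i))"
      using Y.Hausdorff Z_finite Z_sub[of "\<not> i"] B openin_subset[of V B]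
      by (intro closedin_Hausdorff_finite) auto
    then have "openin V (U \<inter> B - Z (\<not> i))"
      using U(1) B by (intro openin_diff openin_Int) auto
    moreover have "z \<in> U \<inter> B - Z (\<not> i)" using U(2) zB zZ by blast
    ultimately obtain N where N: "clopenin V N" "z \<in> N" "N \<subseteq> U \<inter> B - Z (\<not> i)"
      "type_set P Y N = {q \<in> P. p \<le> q}"
      using Y.base[OF p] by blast
    have "N \<subseteq> G i"
    proof
      fix w assume w: "w \<in> N"
      have "q \<in> type_set P X (H i) \<and> (q \<in> F i \<inter> I \<longrightarrow> w \<in> Z i)" if q: "q \<in> P" "w \<in> Y q" for q
      proof (intro conjI impI)
        have pq: "p \<le> q" using Y.type_setI[OF q(1) w q(2)] N(4) by simp
        then show "q \<in> type_set P X (H i)"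
          using X.type_set_upward H(1) pH q(1) by blast
        assume qF: "q \<in> F i \<inter> I"
        then have "p = q" using pq pH
          unfolding F_def minimal_elements_def by (auto simp: order.strict_iff_order)
        then have "w = z" using U(3) w N(3) qF q(2) by blast
        then show "w \<in> Z i" using pZ qF \<open>p = q\<close> by blast
      qed
      then show "w \<in> G i" using w N(3) unfolding G_def by blast
    qed
    with N show "\<exists>T. openin V T \<and> z \<in> T \<and> T \<subseteq> G i" by blast
  qed
  have G_cover: "z \<in> G True \<union> G False" if z: "z \<in> B" for z
  proof -
    obtain q where q: "q \<in> P" "z \<in> Y q"
      using Y.openin_X_cover[of B z] z B by blast
    have q_only: "r = q" if "r \<in> P" "z \<in> Y r" for r
      using Y.X_unique that q by blast
    consider i where "z \<in> Z i" | "z \<notin> Z True" "z \<notin> Z False" by blast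
    then show ?thesis
    proof cases
      case 1
      then have "q \<in> F i" using Z_type q by blast
      then have "z \<in> G i"
        using z q_only F_types(2) 1 Z_disjoint[OF 1] unfolding G_def by auto
      then show ?thesis by (cases i) auto
    next
      \<comment> \<open>An unreserved point follows a minimal type \<open>p\<close> of
        \<open>A\<close> below its own type \<open>q\<close> into a half containing
        \<open>p\<close>. It cannot be counted there, for then \<open>q = p\<close> would be counted
        in \<open>A\<close> as well, and all points of such a piece are reserved by
        \<open>Z_M\<close>.\<close>
      case 2
      have qA: "q \<in> type_set P X A" unfolding TAB by (rule Y.type_setI[OF q(1) z q(2)])
      obtain p where p: "p \<in> ?M" "p \<le> q" using X.minimal_type_below[OF A qA] by blast
      then obtain i where i: "p \<in> type_set P X (H i)"
        using H_cover unfolding minimal_elements_def by blast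
      have "q \<in> type_set P X (H i)"
        using X.type_set_upward[OF _ i q(1) p(2)] H(1) by blast
      moreover have "q \<notin> F i \<inter> I"
      proof
        assume qF: "q \<in> F i \<inter> I"
        then have "p = q" using p(2) i
          unfolding F_def minimal_elements_def by (auto simp: order.strict_iff_order)
        then show False using Z_M[of q z] p(1) qF z q(2) 2 by blast
      qed
      moreover have "z \<notin> Z (\<not> i)" using 2 by (cases i) auto
      ultimately have "z \<in> G i" using z q_only unfolding G_def by blast
      then show ?thesis by (cases i) auto
    qed
  qed
  have "closedin V (B - G False)" "closedin V (B - G True)"
    using B G_open by (auto intro: closedin_diff)
  moreover have "(B - G False) \<inter> (B - G True) = {}" using G_cover by blast
  ultimately obtain N where N: "clopenin V N" "B - G False \<subseteq> N" "N \<inter> (B - G True) = {}"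
    by (rule Y.clopen_separation)
  \<comment> \<open>\<open>N\<close> contains the points barred from \<open>G False\<close> and
    avoids those barred from \<open>G True\<close>, which is what gives
    \<open>K i \<subseteq> G i\<close>.\<close>
  define K where "K i = (if i then B \<inter> N else B - B \<inter> N)" for i
  have K: "clopenin V (K i)" "K i \<subseteq> B" "K i \<subseteq> G i" for i
    using B N by (auto simp: K_def)
  have ZK: "Z i \<subseteq> K i" for i
  proof
    fix z assume z: "z \<in> Z i"
    then have "z \<notin> Z (\<not> i)" "z \<in> B" using Z_disjoint Z_sub by blast+
    moreover have "z \<notin> G (\<not> i)" using z by (simp add: G_def)
    ultimately show "z \<in> K i" using N by (cases i) (auto simp: K_def)
  qed
  have "matched P I X Y (H i) (K i)" for i
    unfolding matched_def
  proof (intro conjI ballI)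
    show "type_set P X (H i) = type_set P Y (K i)"
    proof (intro equalityI subsetI)
      \<comment> \<open>One reserved point for each minimal type suffices, since type sets of open
        sets are upward closed.\<close>
      fix q assume q: "q \<in> type_set P X (H i)"
      obtain p where p: "p \<in> F i" "p \<le> q"
        using X.minimal_type_below[OF H(1) q] unfolding F_def by blast
      have pA: "p \<in> type_set P X A" by (rule F_types(3)[OF p(1)])
      have "S p i \<noteq> {}" using S(2,3)[OF pA, of i] n_pos[OF p(1)] by auto
      then obtain z where z: "z \<in> S p i" by blast
      then have "z \<in> Z i" using p(1) unfolding Z_def by blast
      then have "z \<in> K i" "z \<in> Y p" using ZK[of i] z S(1)[OF pA, of i] by blast+
      then have "p \<in> type_set P Y (K i)" by (intro Y.type_setI F_types(1)[OF p(1)])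
      moreover have "q \<in> P" using q by (simp add: type_set_def)
      ultimately show "q \<in> type_set P Y (K i)" using Y.type_set_upward K(1) p(2) by blast
    next
      fix q assume "q \<in> type_set P Y (K i)"
      then obtain z where "q \<in> P" "z \<in> K i" "z \<in> Y q" by (rule Y.type_setE)
      then show "q \<in> type_set P X (H i)" using K(3)[of i] unfolding G_def by blast
    qed
    fix p assume p: "p \<in> minimal_elements (type_set P X (H i)) \<inter> I"
    then have pF: "p \<in> F i" by (simp add: F_def)
    then have pA: "p \<in> type_set P X A" and pP: "p \<in> P" using F_types by blast+
    have "K i \<inter> Y p = S p i"
    proof (intro equalityI subsetI)
      fix z assume "z \<in> K i \<inter> Y p"
      moreover from this have "z \<in> Z i" using K(3)[of i] p pF pP unfolding G_def by blast
      ultimately show "z \<in> S p i" using Z_type pP by blast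
    next
      fix z assume "z \<in> S p i"
      moreover from this have "z \<in> Z i" using pF unfolding Z_def by blast
      ultimately show "z \<in> K i \<inter> Y p" using ZK[of i] S(1)[OF pA, of i] by blast
    qed
    then show "card (H i \<inter> X p) = card (K i \<inter> Y p)"
      using S(3)[OF pA, of i] pF p by (simp add: n_def)
  qed
  from this[of True] this[of False] K[of True] show thesis
    by (intro that[of "B \<inter> N"]) (auto simp: H_def K_def)
qed

text \<open>Back-and-forth along clopen pairs with equal descriptions; equality of type sets on
  small pairs makes the limit map respect the pieces.\<close>

lemma trim_decomposition_homeomorphism:
  assumes X: "trim_decomposition W P I X" and Y: "trim_decomposition V P I Y" and "I \<subseteq> P"
    and C: "separating_clopens W C" and D: "separating_clopens V D"
  obtains h where "homeomorphic_map W V h" "\<And>p. p \<in> P \<Longrightarrow> h ` X p = Y p"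
proof -
  interpret X: trim_decomposition W P I X by (rule X)
  interpret Y: trim_decomposition V P I Y by (rule Y)
  let ?R = "\<lambda>A B. clopenin W A \<and> clopenin V B \<and> matched P I X Y A B"
  obtain h where h: "homeomorphic_map W V h"
    "\<And>x U U'. x \<in> topspace W \<Longrightarrow> openin W U \<Longrightarrow> x \<in> U \<Longrightarrow> openin V U' \<Longrightarrow> h x \<in> U' \<Longrightarrow>
      \<exists>A B. ?R A B \<and> x \<in> A \<and> A \<subseteq> U \<and> h x \<in> B \<and> B \<subseteq> U'"
  proof (rule back_and_forth[OF X.compact Y.compact C D, of ?R])
    have T: "type_set P X (topspace W) = P" "type_set P Y (topspace V) = P"
      using X.X_nonempty X.X_subset Y.X_nonempty Y.X_subset
      by (auto simp: type_set_def Int_absorb1)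
    \<comment> \<open>The singleton requirement on minimal pieces in \<open>I\<close> is what starts
      the induction: both counts are 1.\<close>
    moreover have "card (topspace W \<inter> X p) = card (topspace V \<inter> Y p)"
      if "p \<in> minimal_elements P \<inter> I" for p
    proof -
      have "p \<in> P" using that by (simp add: minimal_elements_def)
      then have "topspace W \<inter> X p = X p" "topspace V \<inter> Y p = Y p"
        using X.X_subset Y.X_subset by blast+
      then show ?thesis
        using X.isolated Y.isolated that by (simp add: isolated_partition_def)
    qed
    ultimately show "?R (topspace W) (topspace V)" by (simp add: matched_def)
    show "A = {} \<longleftrightarrow> B = {}" if "?R A B" for A B
      using that X.type_set_empty_iff[of A] Y.type_set_empty_iff[of B] openin_subset
      unfolding matched_def by metis
    show "\<exists>B'\<subseteq>B. ?R A' B' \<and> ?R (A - A') (B - B')"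
      if *: "?R A B" "clopenin W A'" "A' \<subseteq> A" for A B A'
    proof -
      obtain B' where "B' \<subseteq> B" "clopenin V B'" "matched P I X Y A' B'" "matched P I X Y (A - A') (B - B')"
        using matched_split[OF X Y, of A B A'] * by blast
      moreover from this have "clopenin W (A - A')" "clopenin V (B - B')" using * by auto
      ultimately show ?thesis using *(2) by blast
    qed
    show "\<exists>A'\<subseteq>A. ?R A' B' \<and> ?R (A - A') (B - B')"
      if *: "?R A B" "clopenin V B'" "B' \<subseteq> B" for A B B'
    proof -
      have BA: "matched P I Y X B A" using *(1) by (subst matched_sym) blast
      obtain A' where "A' \<subseteq> A" "clopenin W A'" "matched P I Y X B' A'" "matched P I Y X (B - B') (A - A')"
        using matched_split[OF Y X _ _ BA, of B'] * by blast
      moreover from this have "clopenin W (A - A')" "clopenin V (B - B')" using * by auto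
      moreover have "matched P I X Y A' B'" "matched P I X Y (A - A') (B - B')"
        using calculation by (simp_all add: matched_sym[of P I X Y])
      ultimately show ?thesis using *(2) by blast
    qed
  qed (blast, erule that, assumption)
  \<comment> \<open>Within trim neighbourhoods of \<open>x\<close> and \<open>h x\<close>, the least
    type of \<open>A\<close> is \<open>p\<close> and the least type of \<open>B\<close> is
    \<open>q\<close>; the type sets agree.\<close>
  have type: "q = p" if p: "p \<in> P" "x \<in> X p" and q: "q \<in> P" "h x \<in> Y q" for p q x
  proof -
    have x: "x \<in> topspace W" and hx: "h x \<in> topspace V"
      using X.X_subset Y.X_subset p q by blast+
    obtain U where U: "openin W U" "x \<in> U" "type_set P X U = {r \<in> P. p \<le> r}"
      using X.base[OF p openin_topspace x] by blast
    obtain U' where U': "openin V U'" "h x \<in> U'" "type_set P Y U' = {r \<in> P. q \<le> r}"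
      using Y.base[OF q openin_topspace hx] by blast
    obtain A B where AB: "?R A B" "x \<in> A" "A \<subseteq> U" "h x \<in> B" "B \<subseteq> U'"
      using h(2)[OF x U(1,2) U'(1,2)] by blast
    have T: "type_set P X A = type_set P Y B" using AB(1) by (simp add: matched_def)
    have "p \<in> type_set P X A" "q \<in> type_set P Y B"
      using X.type_setI[OF p(1) AB(2) p(2)] Y.type_setI[OF q(1) AB(4) q(2)] .
    then have "p \<in> type_set P Y U'" "q \<in> type_set P X U"
      using T X.type_set_mono[OF AB(3)] Y.type_set_mono[OF AB(5)] by auto
    then show ?thesis using U(3) U'(3) by auto
  qed
  have h_surj: "h ` topspace W = topspace V" using h(1) by (rule homeomorphic_imp_surjective_map)
  show thesis
  proof
    show "homeomorphic_map W V h" by (rule h(1))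
    fix p assume p: "p \<in> P"
    show "h ` X p = Y p"
    proof (intro equalityI subsetI)
      fix y assume "y \<in> h ` X p"
      then obtain x where x: "x \<in> X p" "y = h x" by blast
      then have "y \<in> topspace V" using X.X_subset[OF p] h_surj by blast
      then obtain q where "q \<in> P" "y \<in> Y q" by (rule Y.X_cover)
      with type[OF p x(1)] x(2) show "y \<in> Y p" by blast
    next
      fix y assume y: "y \<in> Y p"
      then obtain x where x: "x \<in> topspace W" "y = h x" using Y.X_subset[OF p] h_surj by blast
      then obtain q where "q \<in> P" "x \<in> X q" using X.X_cover by metis
      with type[of q x p] p y x(2) show "y \<in> h ` X p" by blast
    qed
  qed
qed

section \<open>Trim decompositions and trim partitions\<close>

context trim_decomposition
begin

lemma trim_nbhd:
  assumes "p \<in> P" "x \<in> X p" "openin W U" "x \<in> U"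
  shows "\<exists>A. trim_at W P X p A \<and> x \<in> A \<and> A \<subseteq> U"
proof -
  obtain N where N: "clopenin W N" "x \<in> N" "N \<subseteq> U" "type_set P X N = {q \<in> P. p \<le> q}"
    using base[OF assms] by blast
  then have "trim_at W P X p N"
    using assms(1) compact by (simp add: trim_at_def closedin_compact_space)
  with N show ?thesis by blast
qed

lemma trim_atD: "trim_at W P X p A \<Longrightarrow> q \<in> P \<Longrightarrow> x \<in> A \<Longrightarrow> x \<in> X q \<Longrightarrow> p \<le> q"
  using type_setI by (fastforce simp: trim_at_def)

text \<open>A point of \<open>X p\<close> has a \<open>p\<close>-trim neighbourhood, so the required
  supremum is attained. A point of \<open>X q\<close> with a base of \<open>p\<close>-trim sets has
  one inside a \<open>q\<close>-trim neighbourhood, which yields both \<open>p \<le> q\<close> and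
  \<open>q \<le> p\<close>.\<close>

theorem trim_partition: "trim_partition W P X"
proof -
  have "neighbourhood_base_of (trim_set W P X) W"
    unfolding neighbourhood_base_of
  proof (intro allI impI, elim conjE)
    fix U x assume U: "openin W U" "x \<in> U"
    then obtain p where p: "p \<in> P" "x \<in> X p" by (rule openin_X_cover)
    obtain A where A: "trim_at W P X p A" "x \<in> A" "A \<subseteq> U" using trim_nbhd[OF p U] by blast
    then show "\<exists>U' A. openin W U' \<and> trim_set W P X A \<and> x \<in> U' \<and> U' \<subseteq> A \<and> A \<subseteq> U"
      by (intro exI[of _ A]) (auto simp: trim_set_def trim_at_def)
  qed
  moreover have "\<exists>B\<subseteq>A. trim_at W P X p B" if A: "openin W A" "p \<in> type_set P X A" for A p
  proof -
    obtain x where "p \<in> P" "x \<in> A" "x \<in> X p" using A(2) by (rule type_setE)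
    then show ?thesis using trim_nbhd A(1) by blast
  qed
  moreover have trim: "\<exists>A. trim_at W P X p A \<and> x \<in> A" if "p \<in> P" "x \<in> X p" for p x
  proof -
    have "x \<in> topspace W" using that X_subset by blast
    then show ?thesis using trim_nbhd[OF that openin_topspace] by blast
  qed
  moreover have "isLub P {t. \<exists>A. trim_at W P X t A \<and> x \<in> A} p" if p: "p \<in> P" "x \<in> X p" for p x
  proof -
    have "p \<in> {t. \<exists>A. trim_at W P X t A \<and> x \<in> A}" using trim[OF p] by blast
    moreover have "t \<le> p" if "t \<in> {t. \<exists>A. trim_at W P X t A \<and> x \<in> A}" for t
      using that trim_atD[OF _ p(1) _ p(2)] by blast
    ultimately show ?thesis
      using p(1) unfolding isLub_def leastP_def isUb_def setle_def setge_def by blast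
  qed
  moreover have "x \<in> X p"
    if p: "p \<in> P" and x: "x \<in> topspace W" and nb: "neighbourhood_base_at x (trim_at W P X p) W" for p x
  proof -
    obtain q where q: "q \<in> P" "x \<in> X q" using x by (rule X_cover)
    obtain A where A: "trim_at W P X q A" "x \<in> A" using trim[OF q] by blast
    then have "openin W A" by (simp add: trim_at_def)
    then obtain U V where V: "trim_at W P X p V" "x \<in> U" "U \<subseteq> V" "V \<subseteq> A"
      using nb A(2) unfolding neighbourhood_base_at_def by meson
    have "p \<le> q" using trim_atD[OF V(1) q(1) _ q(2)] V(2,3) by blast
    moreover have "p \<in> type_set P X V" using V(1) p by (simp add: trim_at_def)
    then have "p \<in> type_set P X A" using type_set_mono[OF V(4)] by blast
    then have "q \<le> p" using A(1) by (simp add: trim_at_def)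
    ultimately show ?thesis using q(2) by simp
  qed
  moreover have "poset_partition W P X" using complete by (simp add: complete_partition_def)
  ultimately show ?thesis
    unfolding trim_partition_def semi_trim_partition_def by simp
qed

text \<open>The bridge from topology to order: small neighbourhoods of a point of \<open>X q\<close>
  meet exactly the pieces above \<open>q\<close>.\<close>

lemma closure_X_Union:
  assumes "S \<subseteq> P"
  shows "W closure_of (\<Union>p\<in>S. X p) = (\<Union>p\<in>down P S. X p)"
proof (intro equalityI subsetI)
  fix x assume x: "x \<in> W closure_of (\<Union>p\<in>S. X p)"
  then have "x \<in> topspace W" by (simp add: in_closure_of)
  then obtain q where q: "q \<in> P" "x \<in> X q" by (rule X_cover)
  obtain N where N: "openin W N" "x \<in> N" "type_set P X N = {r \<in> P. q \<le> r}"
    using base[OF q openin_topspace \<open>x \<in> topspace W\<close>] by blast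
  obtain p y where "p \<in> S" "y \<in> X p" "y \<in> N" using x N(1,2) unfolding in_closure_of by blast
  then have "q \<le> p" using type_setI[of p y N] assms N(3) by blast
  with \<open>p \<in> S\<close> q show "x \<in> (\<Union>p\<in>down P S. X p)" unfolding down_def by blast
next
  fix x assume "x \<in> (\<Union>p\<in>down P S. X p)"
  then obtain q p where q: "q \<in> P" "x \<in> X q" and p: "p \<in> S" "q \<le> p" unfolding down_def by blast
  show "x \<in> W closure_of (\<Union>p\<in>S. X p)"
    unfolding in_closure_of
  proof (rule conjI, safe)
    show "x \<in> topspace W" using q X_subset by blast
    fix U assume U: "x \<in> U" "openin W U"
    have "p \<in> P" using p(1) assms by blast
    have "p \<in> type_set P X U"
      by (rule type_set_upward[OF U(2) type_setI[OF q(1) U(1) q(2)] \<open>p \<in> P\<close> p(2)])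
    then show "\<exists>y. y \<in> (\<Union>p\<in>S. X p) \<and> y \<in> U" using p(1) by (auto elim!: type_setE)
  qed
qed

text \<open>Needed when the generating open set turns out to be the piece of \<open>Pt 1\<close>
  instead of \<open>Pt 0\<close>.\<close>

lemma reindex:
  assumes \<sigma>: "bij_betw \<sigma> P P" "\<And>p q. p \<in> P \<Longrightarrow> q \<in> P \<Longrightarrow> \<sigma> p \<le> \<sigma> q \<longleftrightarrow> p \<le> q"
    and I: "\<And>p. p \<in> P \<Longrightarrow> \<sigma> p \<in> I \<longleftrightarrow> p \<in> I"
  shows "trim_decomposition W P I (\<lambda>p. X (\<sigma> p))"
proof
  have mem: "\<sigma> p \<in> P" if "p \<in> P" for p using \<sigma>(1) that by (rule bij_betw_apply)
  have inj: "\<sigma> p = \<sigma> q \<longleftrightarrow> p = q" if "p \<in> P" "q \<in> P" for p q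
    using \<sigma>(1) that by (auto simp: bij_betw_def inj_on_def)
  have img: "\<sigma> ` P = P" using \<sigma>(1) by (simp add: bij_betw_def)
  show "compact_space W" "Hausdorff_space W" by (rule compact, rule Hausdorff)
  have "(\<Union>p\<in>P. X (\<sigma> p)) = (\<Union>p\<in>\<sigma> ` P. X p)" by blast
  then have "(\<Union>p\<in>P. X (\<sigma> p)) = topspace W"
    using img complete by (simp add: complete_partition_def)
  moreover have "disjoint_family_on (\<lambda>p. X (\<sigma> p)) P"
    unfolding disjoint_family_on_def using X_unique mem inj by (metis disjoint_iff)
  ultimately show "complete_partition W P (\<lambda>p. X (\<sigma> p))"
    using X_nonempty X_subset mem by (simp add: complete_partition_def poset_partition_def)
  show "\<exists>N. clopenin W N \<and> x \<in> N \<and> N \<subseteq> U \<and> type_set P (\<lambda>p. X (\<sigma> p)) N = {q \<in> P. p \<le> q}"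
    if p: "p \<in> P" and x: "x \<in> X (\<sigma> p)" and U: "openin W U" "x \<in> U" for p x U
  proof -
    obtain N where N: "clopenin W N" "x \<in> N" "N \<subseteq> U" "type_set P X N = {q \<in> P. \<sigma> p \<le> q}"
      using base[OF mem[OF p] x U] by blast
    have "q \<in> type_set P (\<lambda>p. X (\<sigma> p)) N \<longleftrightarrow> \<sigma> q \<in> type_set P X N" if "q \<in> P" for q
      using that mem by (simp add: type_set_def)
    then have "type_set P (\<lambda>p. X (\<sigma> p)) N = {q \<in> P. p \<le> q}"
      using N(4) \<sigma>(2)[OF p] mem by (auto simp: type_set_def)
    with N show ?thesis by blast
  qed
  have "\<sigma> p \<in> minimal_elements P" if p: "p \<in> minimal_elements P" for p
  proof -
    have "\<not> r < \<sigma> p" if rP: "r \<in> P" for r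
    proof
      assume r: "r < \<sigma> p"
      obtain q where q: "q \<in> P" "r = \<sigma> q" using rP img by blast
      then have "q < p" using r \<sigma>(2)[of q p] \<sigma>(2)[of p q] p
        by (auto simp: minimal_elements_def order.strict_iff_not)
      then show False using q p by (auto simp: minimal_elements_def)
    qed
    then show ?thesis using p mem by (auto simp: minimal_elements_def)
  qed
  then show "isolated_partition W P I (\<lambda>p. X (\<sigma> p))"
    using isolated I mem unfolding isolated_partition_def by (auto simp: minimal_elements_def)
qed

end

text \<open>Inside the intersection of \<open>U\<close> with a \<open>p\<close>-trim neighbourhood
  \<open>A\<close>, the semi-trim base gives an \<open>r\<close>-trim \<open>N\<close> around
  \<open>x\<close>: here \<open>r \<le> p\<close> because \<open>x\<close> has type
  \<open>p\<close>, and \<open>p \<le> r\<close> because \<open>N \<subseteq> A\<close>.\<close>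

lemma trim_decompositionI:
  assumes "compact_space W" "Hausdorff_space W" "complete_partition W P X" "trim_partition W P X"
    "isolated_partition W P I X"
  shows "trim_decomposition W P I X"
proof
  fix p x U assume p: "p \<in> P" "x \<in> X p" and U: "openin W U" "x \<in> U"
  obtain A where A: "trim_at W P X p A" "x \<in> A"
    using assms(4) p unfolding trim_partition_def by blast
  have base: "neighbourhood_base_of (trim_set W P X) W"
    using assms(4) unfolding trim_partition_def semi_trim_partition_def by blast
  have "openin W (U \<inter> A)" "x \<in> U \<inter> A" using A U by (auto simp: trim_at_def)
  then obtain V N r where N: "trim_at W P X r N" "x \<in> V" "V \<subseteq> N" "N \<subseteq> U \<inter> A"
    using base unfolding neighbourhood_base_of trim_set_def by meson
  have "p \<in> type_set P X N" using p N(2,3) by (auto simp: type_set_def)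
  then have "r \<le> p" using N(1) by (simp add: trim_at_def)
  moreover have "r \<in> type_set P X N" using N(1) by (simp add: trim_at_def)
  then have "r \<in> type_set P X A" using N(4) by (auto simp: type_set_def)
  then have "p \<le> r" using A(1) by (simp add: trim_at_def)
  ultimately have "r = p" by simp
  have "closedin W N" using assms(2) N(1) by (simp add: trim_at_def compactin_imp_closedin)
  with N \<open>r = p\<close> show "\<exists>N. clopenin W N \<and> x \<in> N \<and> N \<subseteq> U \<and> type_set P X N = {q \<in> P. p \<le> q}"
    by (intro exI[of _ N]) (auto simp: trim_at_def)
qed (use assms in auto)

lemma trim_decomposition_cong:
  assumes "trim_decomposition W P I X" "\<And>p. p \<in> P \<Longrightarrow> X p = Y p"
  shows "trim_decomposition W P I Y"
proof -
  interpret trim_decomposition W P I X by (rule assms(1))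
  have T: "type_set P Y N = type_set P X N" for N
    using assms(2) by (auto simp: type_set_def)
  show ?thesis
  proof
    show "complete_partition W P Y"
      using complete assms(2)
      unfolding complete_partition_def poset_partition_def disjoint_family_on_def by simp
    show "isolated_partition W P I Y"
      using isolated assms(2) unfolding isolated_partition_def by (simp add: minimal_elements_def)
    show "\<exists>N. clopenin W N \<and> x \<in> N \<and> N \<subseteq> U \<and> type_set P Y N = {q \<in> P. p \<le> q}"
      if "p \<in> P" "x \<in> Y p" "openin W U" "x \<in> U" for p x U
      using base[of p x U] that assms(2) by (simp add: T)
  qed (rule compact, rule Hausdorff)
qed

section \<open>Existence of trim decompositions of the Cantor space\<close>

locale cantor_coordinates =
  fixes W :: "'a topology" and f :: "'a \<Rightarrow> nat \<Rightarrow> bool"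
  assumes homeomorphism: "homeomorphic_map W cantor_space f"
begin

lemma compact: "compact_space W" and Hausdorff: "Hausdorff_space W"
proof -
  have "compact_space cantor_space" "Hausdorff_space cantor_space"
    unfolding cantor_space_def
    by (simp_all add: compact_space_product_topology compact_space_discrete_topology
        Hausdorff_space_product_topology)
  moreover have "W homeomorphic_space cantor_space"
    using homeomorphism homeomorphic_space by blast
  ultimately show "compact_space W" "Hausdorff_space W"
    using homeomorphic_compact_space homeomorphic_Hausdorff_space by blast+
qed

lemma surj: "\<exists>y\<in>topspace W. f y = x"
proof -
  have "f ` topspace W = UNIV"
    using homeomorphic_imp_surjective_map[OF homeomorphism] by (simp add: cantor_space_def)
  then show ?thesis by (metis UNIV_I image_iff)
qed

lemma inj: "x \<in> topspace W \<Longrightarrow> y \<in> topspace W \<Longrightarrow> f x = f y \<Longrightarrow> x = y"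
  using homeomorphic_imp_injective_map[OF homeomorphism] by (simp add: inj_on_def)

lemma clopen_coordinate: "clopenin W {y \<in> topspace W. f y i = c}"
proof -
  have "continuous_map W (product_topology (\<lambda>_. discrete_topology UNIV) UNIV) f"
    using homeomorphic_imp_continuous_map[OF homeomorphism] by (simp add: cantor_space_def)
  then have "continuous_map W (discrete_topology UNIV) (\<lambda>y. f y i)"
    by (simp add: continuous_map_componentwise_UNIV)
  then show ?thesis
    using openin_continuous_map_preimage[of W "discrete_topology UNIV" "\<lambda>y. f y i" "{c}"]
      closedin_continuous_map_preimage[of W "discrete_topology UNIV" "\<lambda>y. f y i" "{c}"] by simp
qed

lemma separating: "separating_clopens W (\<lambda>n. {y \<in> topspace W. f y n})"
  unfolding separating_clopens_def
proof (intro conjI allI ballI impI)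
  show "openin W {y \<in> topspace W. f y n}" "closedin W {y \<in> topspace W. f y n}" for n
    using clopen_coordinate[of n True] by simp_all
  fix x y
  assume "x \<in> topspace W" "y \<in> topspace W"
    "\<forall>n. x \<in> {y \<in> topspace W. f y n} \<longleftrightarrow> y \<in> {y \<in> topspace W. f y n}"
  then show "x = y" by (intro inj) auto
qed

text \<open>The bits up to and including \<open>n\<close> are fixed, exactly those on which
  \<open>state x n\<close> depends.\<close>

definition cylinder :: "'a \<Rightarrow> nat \<Rightarrow> 'a set"
  where "cylinder x n = {y \<in> topspace W. \<forall>i\<le>n. f y i = f x i}"

lemma clopen_cylinder: "clopenin W (cylinder x n)"
proof -
  have "cylinder x n = (\<Inter>i\<in>{..n}. {y \<in> topspace W. f y i = f x i})"
    by (auto simp: cylinder_def)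
  then show ?thesis
    using clopen_coordinate by (auto intro!: openin_INT2 closedin_Inter)
qed

text \<open>The bound \<open>m\<close> makes it possible to choose a cylinder beyond the stage where
  the walk has stabilised.\<close>

lemma cylinder_base:
  assumes "openin W U" "x \<in> U"
  shows "\<exists>n\<ge>m. cylinder x n \<subseteq> U"
proof (rule ccontr)
  assume *: "\<not> ?thesis"
  have "(\<Inter>n. cylinder x (m + n) - U) \<noteq> {}"
  proof (rule compact_space_imp_nest[OF compact])
    show "closedin W (cylinder x (m + n) - U)" for n
      using clopen_cylinder assms(1) by (simp add: closedin_diff)
    show "cylinder x (m + n) - U \<noteq> {}" for n
      using * le_add1[of m n] by blast
    show "decseq (\<lambda>n. cylinder x (m + n) - U)"
      unfolding decseq_def cylinder_def by auto
  qed
  then obtain y where y: "\<And>n. y \<in> cylinder x (m + n)" "y \<notin> U" by blast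
  have "f y i = f x i" for i using y(1)[of i] by (simp add: cylinder_def)
  moreover have "y \<in> topspace W" "x \<in> topspace W"
    using y(1)[of 0] assms openin_subset by (auto simp: cylinder_def)
  ultimately have "y = x" using inj by blast
  with y(2) assms(2) show False by simp
qed

end

section \<open>Walks in a poset and their limits\<close>

text \<open>A walk through \<open>P\<close> directed by a bit sequence: the bit \<open>True\<close> stays at the current element and
  advances a counter, the bit \<open>False\<close> moves to the element that \<open>e\<close> proposes and resets the counter.
  The first bit chooses the starting point.\<close>

locale poset_walk =
  fixes P I :: "'p::order set" and a b :: 'p and e :: "'p \<Rightarrow> nat \<Rightarrow> 'p"
  assumes start: "a \<in> P" "b \<in> P"
    and move: "\<And>p k. p \<in> P \<Longrightarrow> e p k \<in> P \<and> p \<le> e p k"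
    and leave: "\<And>p k. p \<in> P \<Longrightarrow> p \<in> I \<Longrightarrow> e p k \<noteq> p"
    and reach: "\<And>p q k. p \<in> P \<Longrightarrow> q \<in> P \<Longrightarrow> p \<le> q \<Longrightarrow> (p \<in> I \<Longrightarrow> q \<noteq> p) \<Longrightarrow> \<exists>j. e p (k + j) = q"
    and generate: "\<And>q. q \<in> P \<Longrightarrow> a \<le> q \<or> b \<le> q"
    and ascending: "\<And>l. mono l \<Longrightarrow> range l \<subseteq> P \<Longrightarrow> \<exists>N. \<forall>n\<ge>N. l n = l (N::nat)"
    and single: "\<And>p. p \<in> minimal_elements P \<Longrightarrow> p \<in> I \<Longrightarrow> a = p \<longleftrightarrow> b \<noteq> p"
begin

primrec state :: "(nat \<Rightarrow> bool) \<Rightarrow> nat \<Rightarrow> 'p \<times> nat" where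
  "state x 0 = (if x 0 then a else b, 0)"
| "state x (Suc n) = (if x (Suc n) then (fst (state x n), Suc (snd (state x n)))
     else (e (fst (state x n)) (snd (state x n)), 0))"

abbreviation label :: "(nat \<Rightarrow> bool) \<Rightarrow> nat \<Rightarrow> 'p"
  where "label x n \<equiv> fst (state x n)"

definition limit :: "(nat \<Rightarrow> bool) \<Rightarrow> 'p"
  where "limit x = (THE p. \<exists>N. \<forall>n\<ge>N. label x n = p)"

lemma label_P: "label x n \<in> P"
  by (induction n) (use start move in auto)

lemma label_mono: "m \<le> n \<Longrightarrow> label x m \<le> label x n"
  by (rule lift_Suc_mono_le[of "label x"]) (use move[OF label_P] in auto)

lemma limit_eqI:
  assumes "\<And>n. n \<ge> N \<Longrightarrow> label x n = p"
  shows "limit x = p"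
  unfolding limit_def
proof (rule the_equality)
  show "\<exists>N. \<forall>n\<ge>N. label x n = p" using assms by blast
  fix q assume "\<exists>N. \<forall>n\<ge>N. label x n = q"
  then obtain M where "\<And>n. n \<ge> M \<Longrightarrow> label x n = q" by blast
  then show "q = p" using assms[of "max N M"] by (metis max.cobounded1 max.cobounded2)
qed

lemma label_limit: "\<exists>N. \<forall>n\<ge>N. label x n = limit x"
proof -
  have "mono (label x)" by (rule monoI) (rule label_mono)
  moreover have "range (label x) \<subseteq> P" by (rule image_subsetI) (rule label_P)
  ultimately have "\<exists>N. \<forall>n\<ge>N. label x n = label x N" by (rule ascending)
  then obtain N where N: "\<forall>n\<ge>N. label x n = label x N" ..
  have lim: "limit x = label x N" by (rule limit_eqI[OF N[rule_format]])
  show ?thesis unfolding lim using N by (rule exI[of _ N])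
qed

lemma limit_P: "limit x \<in> P" and label_le_limit: "label x n \<le> limit x"
proof -
  obtain N where N: "\<forall>n\<ge>N. label x n = limit x" using label_limit by blast
  from N label_P[of x N] show "limit x \<in> P" by simp
  from N label_mono[of n "max n N" x] show "label x n \<le> limit x" by simp
qed

lemma state_cong: "(\<And>i. i \<le> n \<Longrightarrow> x i = y i) \<Longrightarrow> state x n = state y n"
  by (induction n) auto

lemma state_stay:
  "(\<And>i. n < i \<Longrightarrow> i \<le> n + k \<Longrightarrow> x i) \<Longrightarrow> state x (n + k) = (label x n, snd (state x n) + k)"
  by (induction k) auto

lemma limit_stay:
  assumes "\<And>i. n < i \<Longrightarrow> x i"
  shows "limit x = label x n"
proof (rule limit_eqI[of n])
  fix m assume "n \<le> m"
  then show "label x m = label x n"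
    using state_stay[of n "m - n" x] assms by simp
qed

text \<open>Waiting for \<open>j\<close> steps raises the counter by \<open>j\<close>; the only
  later \<open>False\<close> bit, at \<open>Suc (n + j)\<close>, then selects the proposal with this
  counter value.\<close>

lemma limit_jump:
  assumes "\<And>i. n < i \<Longrightarrow> x i = (i \<noteq> Suc (n + j))"
  shows "limit x = e (label x n) (snd (state x n) + j)"
proof -
  have "state x (n + j) = (label x n, snd (state x n) + j)"
    by (rule state_stay) (simp add: assms)
  then have "label x (Suc (n + j)) = e (label x n) (snd (state x n) + j)"
    using assms[of "Suc (n + j)"] by simp
  moreover have "limit x = label x (Suc (n + j))"
    by (rule limit_stay) (simp add: assms)
  ultimately show ?thesis by simp
qed

definition stay :: "(nat \<Rightarrow> bool) \<Rightarrow> nat \<Rightarrow> nat \<Rightarrow> bool"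
  where "stay x n i = (if i \<le> n then x i else True)"

definition jump :: "(nat \<Rightarrow> bool) \<Rightarrow> nat \<Rightarrow> nat \<Rightarrow> nat \<Rightarrow> bool"
  where "jump x n j i = (if i \<le> n then x i else i \<noteq> Suc (n + j))"

lemma limit_stay': "limit (stay x n) = label x n"
  using limit_stay[of n "stay x n"] state_cong[of n "stay x n" x] by (simp add: stay_def)

lemma limit_jump': "limit (jump x n j) = e (label x n) (snd (state x n) + j)"
  using limit_jump[of n "jump x n j" j] state_cong[of n "jump x n j" x] by (simp add: jump_def)

text \<open>From the current label, either stay for ever or wait until \<open>e\<close> proposes
  \<open>q\<close>; \<open>reach\<close> works from any counter value.\<close>

lemma realize:
  assumes "q \<in> P" "label x n \<le> q"
  obtains y where "\<And>i. i \<le> n \<Longrightarrow> y i = x i" "limit y = q"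
proof (cases "q = label x n")
  case True
  then show ?thesis using that[of "stay x n"] limit_stay'[of x n] by (simp add: stay_def)
next
  case False
  obtain j where "e (label x n) (snd (state x n) + j) = q"
    using reach[OF label_P assms] False by blast
  then show ?thesis using that[of "jump x n j"] limit_jump'[of x n j] by (simp add: jump_def)
qed

text \<open>At an element of \<open>I\<close> each \<open>False\<close> bit moves strictly upwards,
  and the walk could not return.\<close>

lemma stays_at_limit:
  assumes "limit x \<in> I" "label x n = limit x" "n < i"
  shows "x i"
proof (rule ccontr)
  assume "\<not> x i"
  moreover obtain m where m: "i = Suc m" "n \<le> m" using assms(3) by (cases i) auto
  ultimately have "label x (Suc m) = e (label x m) (snd (state x m))" by simp
  moreover have between: "label x k = limit x" if "n \<le> k" for k
    using label_mono[OF that, of x] label_le_limit[of x k] assms(2) by simp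
  ultimately show False
    using leave[OF label_P[of x m], of "snd (state x m)"] between[of m] between[of "Suc m"] m(2)
      assms(1) by simp
qed

lemma unique_continuation:
  assumes "limit x \<in> I" "limit y = limit x" "label x n = limit x" "\<And>i. i \<le> n \<Longrightarrow> x i = y i"
  shows "x = y"
proof
  fix i
  have "label y n = limit y" using state_cong[OF assms(4), of n] assms(2,3) by simp
  then show "x i = y i"
    using stays_at_limit[of x n i] stays_at_limit[of y n i] assms by (cases "i \<le> n") auto
qed

text \<open>Outside \<open>I\<close> the map \<open>e\<close> also proposes the current element. So
  \<open>stay\<close> and a \<open>jump\<close> back to the same element have equal limits but
  differ in one bit, and at most one of them is \<open>x\<close>.\<close>

lemma other_continuation:
  assumes "limit x \<notin> I"
  obtains y where "y \<noteq> x" "limit y = limit x" "\<And>i. i \<le> n \<Longrightarrow> y i = x i"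
proof -
  obtain N where "\<forall>n\<ge>N. label x n = limit x" using label_limit by blast
  then obtain m where m: "n \<le> m" "label x m = limit x" by (meson max.cobounded1 max.cobounded2)
  obtain j where j: "e (limit x) (snd (state x m) + j) = limit x"
    using reach[OF limit_P limit_P, of x x "snd (state x m)"] assms by auto
  have "stay x m (Suc (m + j)) \<noteq> jump x m j (Suc (m + j))" by (simp add: stay_def jump_def)
  then consider "stay x m \<noteq> x" | "jump x m j \<noteq> x" by metis
  then show thesis
  proof cases
    case 1
    then show thesis using that[of "stay x m"] limit_stay'[of x m] m by (simp add: stay_def)
  next
    case 2
    then show thesis using that[of "jump x m j"] limit_jump'[of x m j] m j by (simp add: jump_def)
  qed
qed

end

section \<open>Pieces of the Cantor space given by limits of walks\<close>

locale cantor_walk = cantor_coordinates W f + poset_walk P I a b e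
  for W :: "'a topology" and f and P I :: "'p::order set" and a b e
begin

definition piece :: "'p \<Rightarrow> 'a set"
  where "piece p = {y \<in> topspace W. limit (f y) = p}"

sublocale trim_decomposition W P I piece
proof
  show "compact_space W" "Hausdorff_space W" by (rule compact, rule Hausdorff)
  have "piece q \<noteq> {}" if q: "q \<in> P" for q
  proof -
    \<comment> \<open>The first bit, the truth value of \<open>a \<le> q\<close>, selects a starting
      point below \<open>q\<close>.\<close>
    have "label (\<lambda>_. a \<le> q) 0 \<le> q" using generate[OF q] by auto
    then obtain y where "limit y = q" by (rule realize[OF q])
    then show ?thesis using surj[of y] by (auto simp: piece_def)
  qed
  then show "complete_partition W P piece"
    using limit_P
    by (auto simp: complete_partition_def poset_partition_def piece_def disjoint_family_on_def)
  show "\<exists>N. clopenin W N \<and> x \<in> N \<and> N \<subseteq> U \<and> type_set P piece N = {q \<in> P. p \<le> q}"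
    if p: "p \<in> P" "x \<in> piece p" and U: "openin W U" "x \<in> U" for p x U
  proof -
    obtain N where N: "\<forall>n\<ge>N. label (f x) n = limit (f x)" using label_limit by blast
    obtain n where n: "n \<ge> N" "cylinder x n \<subseteq> U" using cylinder_base[OF U] by blast
    have lab: "label (f x) n = p" and xW: "x \<in> topspace W" using N n(1) p(2) by (auto simp: piece_def)
    \<comment> \<open>All walks in the cylinder have label \<open>p\<close> at stage
      \<open>n\<close>, and from there they can reach precisely the elements above
      \<open>p\<close>.\<close>
    have "q \<in> type_set P piece (cylinder x n) \<longleftrightarrow> p \<le> q" if q: "q \<in> P" for q
    proof
      assume "q \<in> type_set P piece (cylinder x n)"
      then obtain y where y: "y \<in> cylinder x n" "limit (f y) = q"
        by (auto simp: type_set_def piece_def)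
      have "state (f y) n = state (f x) n"
        using y(1) by (intro state_cong) (simp add: cylinder_def)
      then show "p \<le> q" using label_le_limit[of "f y" n] y(2) lab by simp
    next
      assume "p \<le> q"
      then obtain z where z: "\<And>i. i \<le> n \<Longrightarrow> z i = f x i" "limit z = q"
        using realize[OF q, of "f x" n] lab by blast
      obtain y where "y \<in> topspace W" "f y = z" using surj by blast
      then have "y \<in> cylinder x n \<inter> piece q" using z by (simp add: cylinder_def piece_def)
      then show "q \<in> type_set P piece (cylinder x n)" using q unfolding type_set_def by blast
    qed
    then have "type_set P piece (cylinder x n) = {q \<in> P. p \<le> q}" by (auto simp: type_set_def)
    moreover have "x \<in> cylinder x n" using xW by (simp add: cylinder_def)
    ultimately show ?thesis using clopen_cylinder n(2) by blast
  qed
  have "\<not> isolated_point W (piece p) x" if p: "p \<notin> I" for p x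
  proof
    assume "isolated_point W (piece p) x"
    then obtain U where x: "x \<in> piece p" and U: "openin W U" "U \<inter> piece p = {x}"
      unfolding isolated_point_def by blast
    obtain n where n: "cylinder x n \<subseteq> U" using cylinder_base[OF U(1)] U(2) by blast
    have lim: "limit (f x) = p" using x by (simp add: piece_def)
    obtain z where z: "z \<noteq> f x" "limit z = p" "\<And>i. i \<le> n \<Longrightarrow> z i = f x i"
      using other_continuation[of "f x" n] p lim by metis
    obtain y where "y \<in> topspace W" "f y = z" using surj by blast
    then have "y \<in> cylinder x n \<inter> piece p" "y \<noteq> x" using z by (auto simp: cylinder_def piece_def)
    then show False using n U(2) by blast
  qed
  moreover have "isolated_point W (piece p) x" if p: "p \<in> I" "x \<in> piece p" for p x
  proof -
    have x: "x \<in> topspace W" "limit (f x) = p" using p(2) by (auto simp: piece_def)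
    obtain n where n: "label (f x) n = p" using label_limit[of "f x"] x(2) by blast
    have "y = x" if "y \<in> cylinder x n" "y \<in> piece p" for y
    proof (rule inj)
      show "f y = f x"
        using unique_continuation[of "f x" "f y" n] that x n p(1)
        by (simp add: cylinder_def piece_def)
    qed (use that x in \<open>auto simp: piece_def\<close>)
    then have "cylinder x n \<inter> piece p = {x}" using p(2) x(1) by (auto simp: cylinder_def)
    then show ?thesis unfolding isolated_point_def using p(2) clopen_cylinder by blast
  qed
  \<comment> \<open>A walk with minimal limit \<open>p\<close> is at \<open>p\<close> from the
    start. By \<open>single\<close> this determines the first bit, and at an element of
    \<open>I\<close> the remaining bits are forced.\<close>
  moreover have "card (piece p) = 1" if p: "p \<in> minimal_elements P \<inter> I" for p
  proof -
    have pP: "p \<in> P" using p by (simp add: minimal_elements_def)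
    have lab: "label (f x) 0 = p" if "x \<in> piece p" for x
      using label_le_limit[of "f x" 0] label_P[of "f x" 0] p that
      by (auto simp: minimal_elements_def piece_def order.order_iff_strict)
    obtain x where x: "x \<in> piece p" using \<open>\<And>q. q \<in> P \<Longrightarrow> piece q \<noteq> {}\<close>[OF pP] by blast
    have "y = x" if y: "y \<in> piece p" for y
    proof (rule inj)
      have "f x 0 = f y 0"
        using lab[OF x] lab[OF y] single[of p] p by (auto split: if_splits)
      then show "f y = f x"
        using unique_continuation[of "f x" "f y" 0] lab[OF x] p x y by (simp add: piece_def)
    qed (use x y in \<open>auto simp: piece_def\<close>)
    then have "piece p = {x}" using x by blast
    then show ?thesis by simp
  qed
  ultimately show "isolated_partition W P I piece" by (simp add: isolated_partition_def)
qed

end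

text \<open>The counter is decoded as a pair whose first component indexes an enumeration of the
  permitted targets. The free second component makes each target recur at arbitrarily large counter
  values, as \<open>reach\<close> requires.\<close>

lemma poset_walk_exists:
  fixes P I :: "'p::order set"
  assumes "countable P" "\<And>p. p \<in> P \<Longrightarrow> p \<in> I \<Longrightarrow> \<exists>q\<in>P. p < q" "a \<in> P" "b \<in> P"
    "\<And>q. q \<in> P \<Longrightarrow> a \<le> q \<or> b \<le> q"
    "\<And>l. mono l \<Longrightarrow> range l \<subseteq> P \<Longrightarrow> \<exists>N. \<forall>n\<ge>N. l n = l (N::nat)"
    "\<And>p. p \<in> minimal_elements P \<Longrightarrow> p \<in> I \<Longrightarrow> a = p \<longleftrightarrow> b \<noteq> p"
  obtains e where "poset_walk P I a b e"
proof -
  define S where "S p = {q \<in> P. p \<le> q \<and> (p \<in> I \<longrightarrow> q \<noteq> p)}" for p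
  have S_ne: "S p \<noteq> {}" if p: "p \<in> P" for p
  proof (cases "p \<in> I")
    case True
    then obtain q where "q \<in> P" "p < q" using assms(2)[OF p] by blast
    then have "q \<in> S p" by (auto simp: S_def)
    then show ?thesis by blast
  next
    case False
    then have "p \<in> S p" using p by (simp add: S_def)
    then show ?thesis by blast
  qed
  have "countable (S p)" for p
    using assms(1) by (rule countable_subset[rotated]) (auto simp: S_def)
  then have surj: "\<exists>m. from_nat_into (S p) m = q" if "q \<in> S p" for p q
    using that by (rule from_nat_into_surj)
  define e where "e p k = from_nat_into (S p) (fst (prod_decode k))" for p k
  have e: "e p k \<in> S p" if "p \<in> P" for p k
    unfolding e_def by (rule from_nat_into[OF S_ne[OF that]])
  have "poset_walk P I a b e"
  proof
    show "e p k \<in> P \<and> p \<le> e p k" if "p \<in> P" for p k using e[OF that, of k] by (simp add: S_def)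
    show "e p k \<noteq> p" if "p \<in> P" "p \<in> I" for p k using e[OF that(1), of k] that(2) by (simp add: S_def)
    show "\<exists>j. e p (k + j) = q" if q: "p \<in> P" "q \<in> P" "p \<le> q" "p \<in> I \<Longrightarrow> q \<noteq> p" for p q k
    proof -
      obtain m where m: "from_nat_into (S p) m = q" using surj[of q p] q unfolding S_def by blast
      have "k + (prod_encode (m, k) - k) = prod_encode (m, k)" using le_prod_encode_2[of k m] by simp
      then show ?thesis using m by (intro exI[of _ "prod_encode (m, k) - k"]) (simp add: e_def)
    qed
  qed (use assms in auto)
  then show thesis by (rule that)
qed

section \<open>Finite and cofinite subsets of the posets\<close>

definition zigzag :: "pt set \<Rightarrow> bool"
  where "zigzag P \<longleftrightarrow> P = P_inf \<or> (\<exists>(m, n)\<in>J. P = P_fin m n)"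

lemma zigzag_cases:
  assumes "zigzag P"
  obtains (inf) "P = range Pt" | (initial) m where "P = Pt ` {..m}"
    | (gap) m where "P = insert (Pt (m + 2)) (Pt ` {..m})"
proof -
  consider "P = P_inf" | m n where "n = 0 \<or> n = 2" "P = P_fin m n"
    using assms unfolding zigzag_def J_def by auto
  then show thesis
    using that by cases (auto simp: P_inf_def P_fin_def split: if_splits)
qed

lemma pt_le [simp]: "Pt k \<le> Pt j \<longleftrightarrow> j + 2 \<le> k \<or> k = j" "Bot \<le> x" "Pt k \<le> Bot \<longleftrightarrow> False"
  by (cases x; auto simp: less_eq_pt_def)+

lemma zigzag_subset: "zigzag P \<Longrightarrow> P \<subseteq> range Pt"
  by (erule zigzag_cases) auto

lemma Bot_notin_zigzag: "zigzag P \<Longrightarrow> Bot \<notin> P"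
  by (drule zigzag_subset) auto

lemma Pt_0_in_zigzag: "zigzag P \<Longrightarrow> Pt 0 \<in> P"
  by (erule zigzag_cases) auto

lemma infinite_P_inf: "infinite P_inf"
  unfolding P_inf_def by (rule range_inj_infinite) (simp add: inj_on_def)

lemma zigzag_infinite: "zigzag P \<Longrightarrow> infinite P \<longleftrightarrow> P = P_inf"
  using infinite_P_inf by (auto simp: P_inf_def elim: zigzag_cases)

lemma P_tilde_zigzag: "zigzag P \<Longrightarrow> P_tilde P = (if finite P then P else insert Bot P)"
  using zigzag_infinite by (auto simp: P_tilde_def bot_pt_def)

text \<open>The only index skipped inside \<open>P\<close> is \<open>m + 1\<close> in
  \<open>P(m,2)\<close>, and only \<open>m + 2\<close> comes after it.\<close>

lemma zigzag_gap: "zigzag P \<Longrightarrow> Pt k \<notin> P \<Longrightarrow> Pt j \<in> P \<Longrightarrow> Suc k \<le> j \<Longrightarrow> j = Suc k"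
  by (erule zigzag_cases) auto

definition fincofin :: "'p set \<Rightarrow> 'p set set"
  where "fincofin P = {S. S \<subseteq> P \<and> (finite S \<or> finite (P - S))}"

lemma fincofinD: "S \<in> fincofin P \<Longrightarrow> S \<subseteq> P"
  by (simp add: fincofin_def)

lemma fincofin_finite: "S \<subseteq> P \<Longrightarrow> finite S \<Longrightarrow> S \<in> fincofin P"
  by (simp add: fincofin_def)

lemma closure_subalgebraD:
  assumes "closure_subalgebra \<Omega> c M"
  shows "{} \<in> M" "x \<in> M \<Longrightarrow> \<Omega> - x \<in> M" "x \<in> M \<Longrightarrow> y \<in> M \<Longrightarrow> x \<union> y \<in> M"
    "x \<in> M \<Longrightarrow> c x \<in> M" "x \<in> M \<Longrightarrow> y \<in> M \<Longrightarrow> x - y \<in> M" "x \<in> M \<Longrightarrow> x \<subseteq> \<Omega>"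
    "finite F \<Longrightarrow> F \<subseteq> M \<Longrightarrow> \<Union>F \<in> M"
proof -
  have M: "algebra \<Omega> M" using assms by (simp add: closure_subalgebra_def)
  then interpret algebra \<Omega> M .
  show "{} \<in> M" "x \<in> M \<Longrightarrow> \<Omega> - x \<in> M" "x \<in> M \<Longrightarrow> y \<in> M \<Longrightarrow> x \<union> y \<in> M"
    "x \<in> M \<Longrightarrow> y \<in> M \<Longrightarrow> x - y \<in> M" "x \<in> M \<Longrightarrow> x \<subseteq> \<Omega>"
    "finite F \<Longrightarrow> F \<subseteq> M \<Longrightarrow> \<Union>F \<in> M"
    using sets_into_space by auto
  show "x \<in> M \<Longrightarrow> c x \<in> M" using assms by (simp add: closure_subalgebra_def)
qed

lemma closure_subalgebraI:
  assumes "M \<subseteq> Pow \<Omega>" "{} \<in> M" "\<And>x. x \<in> M \<Longrightarrow> \<Omega> - x \<in> M"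
    "\<And>x y. x \<in> M \<Longrightarrow> y \<in> M \<Longrightarrow> x \<union> y \<in> M" "\<And>x. x \<in> M \<Longrightarrow> c x \<in> M"
  shows "closure_subalgebra \<Omega> c M"
  using assms by (simp add: closure_subalgebra_def algebra_iff_Un)

lemma generated_subalgebra_minimal:
  "G \<subseteq> M \<Longrightarrow> closure_subalgebra \<Omega> c M \<Longrightarrow> generated_subalgebra \<Omega> c G \<subseteq> M"
  unfolding generated_subalgebra_def by (rule hull_minimal)

lemma down_subset: "down P S \<subseteq> P"
  by (auto simp: down_def)

text \<open>An element \<open>Pt k\<close> of \<open>S\<close> lies above all elements of index at
  least \<open>k + 2\<close>.\<close>

lemma down_cofinite:
  assumes "zigzag P" "S \<subseteq> P" "S \<noteq> {}"
  shows "finite (P - down P S)"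
proof -
  obtain k where k: "Pt k \<in> S" using assms zigzag_subset by blast
  have "P - down P S \<subseteq> Pt ` {..Suc k}"
  proof
    fix p assume p: "p \<in> P - down P S"
    then obtain j where "p = Pt j" using assms(1) zigzag_subset by blast
    with p k show "p \<in> Pt ` {..Suc k}" unfolding down_def by force
  qed
  then show ?thesis by (rule finite_subset) simp
qed

lemma down_fincofin: "zigzag P \<Longrightarrow> S \<subseteq> P \<Longrightarrow> down P S \<in> fincofin P"
  using down_cofinite[of P S] by (cases "S = {}") (auto simp: fincofin_def down_def)

lemma closure_subalgebra_fincofin:
  assumes "zigzag P"
  shows "closure_subalgebra P (down P) (fincofin P)"
proof (rule closure_subalgebraI)
  show "P - S \<in> fincofin P" if "S \<in> fincofin P" for S
    using that by (auto simp: fincofin_def double_diff)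
  show "S \<union> T \<in> fincofin P" if "S \<in> fincofin P" "T \<in> fincofin P" for S T
    using that by (auto simp: fincofin_def intro: finite_subset[of "P - (S \<union> T)" "P - S"]
        finite_subset[of "P - (S \<union> T)" "P - T"])
  show "down P S \<in> fincofin P" if "S \<in> fincofin P" for S
    using down_fincofin[OF assms fincofinD[OF that]] .
qed (auto simp: fincofin_def)

text \<open>Singletons are obtained by induction on the index. Among the elements \<open>R\<close>
  of index at least \<open>k\<close>, only \<open>Pt k\<close> escapes the closure of
  \<open>{Pt (k - 1)}\<close>; if \<open>Pt (k - 1)\<close> is missing, \<open>R\<close> itself is
  already \<open>{Pt k} \<inter> P\<close>.\<close>

lemma fincofin_generated:
  assumes P: "zigzag P" and M: "closure_subalgebra P (down P) M" and start: "{Pt 0} \<in> M"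
  shows "fincofin P \<subseteq> M"
proof -
  note M' = closure_subalgebraD[OF M]
  have single: "{Pt k} \<inter> P \<in> M" for k
  proof (induction k rule: less_induct)
    case (less k)
    show ?case
    proof (cases k)
      case 0
      then show ?thesis using start M'(6)[OF start] by (simp add: Int_absorb2)
    next
      case (Suc i)
      define R where "R = P - \<Union>((\<lambda>j. {Pt j} \<inter> P) ` {..<k})"
      have R: "R \<in> M" unfolding R_def using less.IH by (intro M'(2) M'(7)) auto
      have R_iff: "Pt j \<in> R \<longleftrightarrow> Pt j \<in> P \<and> k \<le> j" for j unfolding R_def by auto
      have R_Pt: "\<exists>j. p = Pt j" if "p \<in> R" for p
        using that zigzag_subset[OF P] unfolding R_def by blast
      show ?thesis
      proof (cases "Pt i \<in> P")
        case True
        have down: "Pt j \<in> down P ({Pt i} \<inter> P) \<longleftrightarrow> Pt j \<in> P \<and> (j = i \<or> i + 2 \<le> j)" for j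
          using True by (auto simp: down_def)
        have "{Pt k} \<inter> P = R - down P ({Pt i} \<inter> P)"
        proof (intro equalityI subsetI)
          fix p assume "p \<in> {Pt k} \<inter> P"
          then show "p \<in> R - down P ({Pt i} \<inter> P)" using R_iff down Suc by auto
        next
          fix p assume p: "p \<in> R - down P ({Pt i} \<inter> P)"
          then obtain j where "p = Pt j" using R_Pt by blast
          with p R_iff[of j] down[of j] Suc show "p \<in> {Pt k} \<inter> P" by auto
        qed
        moreover have "{Pt i} \<inter> P \<in> M" by (rule less.IH) (simp add: Suc)
        ultimately show ?thesis using M'(4,5) R by simp
      next
        case False
        have "{Pt k} \<inter> P = R"
        proof (intro equalityI subsetI)
          fix p assume "p \<in> {Pt k} \<inter> P"
          then show "p \<in> R" using R_iff by auto
        next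
          fix p assume p: "p \<in> R"
          then obtain j where "p = Pt j" using R_Pt by blast
          with p R_iff[of j] zigzag_gap[OF P False, of j] Suc show "p \<in> {Pt k} \<inter> P" by auto
        qed
        with R show ?thesis by simp
      qed
    qed
  qed
  have fin: "S \<in> M" if S: "S \<subseteq> P" "finite S" for S
  proof -
    have "{p} \<in> M" if p: "p \<in> S" for p
    proof -
      obtain k where "p = Pt k" using p S(1) zigzag_subset[OF P] by blast
      then show ?thesis using single[of k] p S(1) by (simp add: Int_absorb2 subsetD)
    qed
    then have "\<Union>((\<lambda>p. {p}) ` S) \<in> M" using S(2) by (intro M'(7)) auto
    then show ?thesis by simp
  qed
  show ?thesis
  proof
    fix S assume S: "S \<in> fincofin P"
    show "S \<in> M"
    proof (cases "finite S")
      case True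
      then show ?thesis using fin S by (simp add: fincofin_def)
    next
      case False
      then have "P - S \<in> M" using fin S by (simp add: fincofin_def)
      then have "P - (P - S) \<in> M" by (rule M'(2))
      then show ?thesis using S by (simp add: fincofin_def double_diff)
    qed
  qed
qed

lemma \<E>_zigzag:
  assumes "zigzag P"
  shows "\<E> P = fincofin P"
proof
  have "L = down P L" if "L \<in> lower_subsets P" for L
    using that by (auto simp: lower_subsets_def down_def)
  then have "lower_subsets P \<subseteq> fincofin P"
    using down_fincofin[OF assms] unfolding lower_subsets_def by (metis (no_types, lifting) mem_Collect_eq subsetI)
  then show "\<E> P \<subseteq> fincofin P"
    unfolding \<E>_def by (rule generated_subalgebra_minimal) (rule closure_subalgebra_fincofin[OF assms])
  have E: "closure_subalgebra P (down P) (\<E> P)"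
    unfolding \<E>_def
    by (rule closure_subalgebra_generated[OF closure_algebra_Pow_down]) (auto simp: lower_subsets_def)
  have lower: "lower_subsets P \<subseteq> \<E> P"
    unfolding \<E>_def generated_subalgebra_def by (rule hull_subset)
  \<comment> \<open>\<open>{Pt 0}\<close> is the difference of the lower sets of elements below it,
    with and without itself.\<close>
  have "down P {Pt 0} \<in> lower_subsets P" "{p \<in> P. p < Pt 0} \<in> lower_subsets P"
    by (auto simp: lower_subsets_def down_def)
  then have "down P {Pt 0} - {p \<in> P. p < Pt 0} \<in> \<E> P"
    using lower by (intro closure_subalgebraD(5)[OF E]) blast+
  moreover have "down P {Pt 0} - {p \<in> P. p < Pt 0} = {Pt 0}"
    using Pt_0_in_zigzag[OF assms] by (auto simp: down_def order.order_iff_strict)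
  ultimately show "fincofin P \<subseteq> \<E> P"
    using fincofin_generated[OF assms E] by simp
qed

text \<open>Every other upper set is excluded by a closure subalgebra that contains it but not
  \<open>{Pt 0}\<close>: either one that does not separate \<open>Pt 0\<close> from
  \<open>Pt 2\<close>, or one with at most four members.\<close>

lemma generating_upper_set:
  assumes P: "zigzag P" and U: "U \<in> fincofin P" "U \<noteq> {}" and upper: "down P (P - U) = P - U"
    and gen: "\<And>K. closure_subalgebra P (down P) K \<Longrightarrow> K \<subseteq> fincofin P \<Longrightarrow> U \<in> K \<Longrightarrow> {Pt 0} \<in> K"
  shows "U = {Pt 0} \<or> U = {Pt 1} \<and> Pt 2 \<notin> P"
proof -
  have UP: "U \<subseteq> P" by (rule fincofinD[OF U(1)])
  have up: "q \<in> U" if "p \<in> U" "q \<in> P" "p \<le> q" for p q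
    using that upper UP by (auto simp: down_def)
  have P0: "Pt 0 \<in> P" by (rule Pt_0_in_zigzag[OF P])
  note fc = closure_subalgebra_fincofin[OF P]
  have two: "Pt 0 \<in> U \<and> Pt 2 \<notin> U" if P2: "Pt 2 \<in> P"
  proof (rule ccontr)
    assume "\<not> ?thesis"
    then have eq: "Pt 0 \<in> U \<longleftrightarrow> Pt 2 \<in> U" using up[of "Pt 2" "Pt 0"] P0 by auto
    \<comment> \<open>Closed under \<open>down\<close>, because \<open>Pt 0\<close> is maximal and
      the only element strictly above \<open>Pt 2\<close> is \<open>Pt 0\<close>.\<close>
    define K where "K = {S \<in> fincofin P. Pt 0 \<in> S \<longleftrightarrow> Pt 2 \<in> S}"
    have "closure_subalgebra P (down P) K"
    proof (rule closure_subalgebraI)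
      show "down P S \<in> K" if "S \<in> K" for S
      proof -
        have S: "S \<in> fincofin P" "Pt 0 \<in> S \<longleftrightarrow> Pt 2 \<in> S" using that by (auto simp: K_def)
        have "Pt 0 \<in> down P S \<longleftrightarrow> Pt 2 \<in> down P S"
        proof -
          have "Pt 0 \<le> q \<longleftrightarrow> q = Pt 0" "Pt 2 \<le> q \<longleftrightarrow> q = Pt 0 \<or> q = Pt 2" for q
            by (cases q; auto)+
          then show ?thesis using S(2) P0 P2 by (auto simp: down_def)
        qed
        then show ?thesis using closure_subalgebraD(4)[OF fc] S(1) by (simp add: K_def)
      qed
    qed (use closure_subalgebraD(1-3)[OF fc] P0 P2 in \<open>auto simp: K_def dest: subsetD[OF fincofinD]\<close>)
    moreover have "K \<subseteq> fincofin P" "U \<in> K" using eq U(1) by (auto simp: K_def)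
    ultimately have "{Pt 0} \<in> K" by (rule gen)
    then show False by (auto simp: K_def)
  qed
  have one: "Pt 0 \<notin> U" if P1: "Pt 1 \<in> U"
  proof
    assume U0: "Pt 0 \<in> U"
    have "down P U = P"
    proof (intro equalityI subsetI)
      fix p assume p: "p \<in> P"
      then obtain k where k: "p = Pt k" using zigzag_subset[OF P] by blast
      consider "k = 0" | "k = 1" | "2 \<le> k" by linarith
      then have "\<exists>q\<in>U. p \<le> q" using U0 P1 k by cases (auto intro: bexI[of _ "Pt 0"])
      then show "p \<in> down P U" using p by (simp add: down_def)
    qed (simp add: down_def)
    \<comment> \<open>\<open>U\<close> is dense and its complement closed, so no further sets
      arise.\<close>
    define K where "K = {{}, U, P - U, P}"
    have "closure_subalgebra P (down P) K"
    proof (rule closure_subalgebraI)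
      show "S \<union> T \<in> K" if "S \<in> K" "T \<in> K" for S T
        using that UP unfolding K_def by (elim insertE emptyE) (simp_all add: Un_absorb1 Un_absorb2)
      have "down P P = P" "down P {} = {}" by (auto simp: down_def)
      then show "down P S \<in> K" if "S \<in> K" for S
        using that upper \<open>down P U = P\<close> unfolding K_def by auto
    qed (use UP in \<open>auto simp: K_def\<close>)
    moreover have "K \<subseteq> fincofin P"
      using U(1) closure_subalgebraD(1,2)[OF fc] closure_subalgebraD(2)[OF fc, of "{}"]
      by (simp add: K_def)
    moreover have "U \<in> K" by (simp add: K_def)
    ultimately have "{Pt 0} \<in> K" by (rule gen)
    then show False using U0 P1 UP P0 by (auto simp: K_def)
  qed
  have small: "k < 2" if k: "Pt k \<in> U" for k
  proof (rule ccontr)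
    assume "\<not> k < 2"
    then have U0: "Pt 0 \<in> U" using up[OF k P0] by simp
    consider "k = 2" | "3 \<le> k" using \<open>\<not> k < 2\<close> by linarith
    then show False
    proof cases
      case 1
      then show False using two k UP by blast
    next
      case 2
      \<comment> \<open>If \<open>Pt 1\<close> were missing, the only possible later index would be
        2.\<close>
      have "Pt 1 \<in> P" using zigzag_gap[OF P, of 1 k] 2 k UP
        by (cases "Pt 1 \<in> P") (use 2 in auto)
      then have "Pt 1 \<in> U" using up[OF k, of "Pt 1"] 2 by simp
      with one U0 show False by blast
    qed
  qed
  have "U \<subseteq> {Pt 0, Pt 1}"
  proof
    fix p assume p: "p \<in> U"
    then obtain k where "p = Pt k" using UP zigzag_subset[OF P] by blast
    with small[of k] p show "p \<in> {Pt 0, Pt 1}" by (auto simp: less_2_cases_iff)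
  qed
  then have "U = {Pt 0} \<or> U = {Pt 1}" using one U(2) by auto
  then show ?thesis using two by auto
qed

section \<open>Isomorphisms of closure algebras\<close>

lemma iso_preimage:
  assumes iso: "closure_algebra_iso \<Omega> c M \<Omega>' c' M' \<phi>" and M: "closure_subalgebra \<Omega> c M"
    and N: "closure_subalgebra \<Omega>' c' N"
  shows "closure_subalgebra \<Omega> c {x \<in> M. \<phi> x \<in> N}"
proof -
  have \<phi>: "\<phi> (x \<union> y) = \<phi> x \<union> \<phi> y" "\<phi> (x \<inter> y) = \<phi> x \<inter> \<phi> y" "\<phi> (\<Omega> - x) = \<Omega>' - \<phi> x"
    "\<phi> (c x) = c' (\<phi> x)" if "x \<in> M" "y \<in> M" for x y
    using iso that by (simp_all add: closure_algebra_iso_def)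
  note M' = closure_subalgebraD[OF M] and N' = closure_subalgebraD[OF N]
  \<comment> \<open>The empty set is \<open>{} \<inter> (\<Omega> - {})\<close>, whose image is the
    meet of \<open>\<phi> {}\<close> with its own complement.\<close>
  have "\<phi> {} = {}" using \<phi>(2)[OF M'(1) M'(2)[OF M'(1)]] \<phi>(3)[OF M'(1) M'(1)] by auto
  then show ?thesis
    by (intro closure_subalgebraI) (use M'(1-4) N'(1-4) \<phi> in \<open>auto dest: subsetD[OF M'(6)]\<close>)
qed

lemma iso_image:
  assumes iso: "closure_algebra_iso \<Omega> c M \<Omega>' c' M' \<phi>" and K: "closure_subalgebra \<Omega> c K" "K \<subseteq> M"
  shows "closure_subalgebra \<Omega>' c' (\<phi> ` K)"
proof -
  note K' = closure_subalgebraD[OF K(1)]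
  have \<phi>: "\<phi> (x \<union> y) = \<phi> x \<union> \<phi> y" "\<phi> (x \<inter> y) = \<phi> x \<inter> \<phi> y" "\<phi> (\<Omega> - x) = \<Omega>' - \<phi> x"
    "\<phi> (c x) = c' (\<phi> x)" if "x \<in> K" "y \<in> K" for x y
    using iso that K(2) unfolding closure_algebra_iso_def by blast+
  have "\<phi> {} = {}" using \<phi>(2)[OF K'(1) K'(2)[OF K'(1)]] \<phi>(3)[OF K'(1) K'(1)] by auto
  moreover have "\<phi> x \<subseteq> \<Omega>'" if "x \<in> K" for x
  proof -
    have "\<Omega> - (\<Omega> - x) = x" using K'(6)[OF that] by blast
    then show ?thesis using \<phi>(3)[OF K'(2)[OF that] that] by auto
  qed
  ultimately show ?thesis
    by (intro closure_subalgebraI) (auto simp: K' \<phi>[symmetric] intro!: imageI image_eqI[of "{}" \<phi> "{}"])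
qed

section \<open>The closure algebra of a trim decomposition\<close>

locale zigzag_decomposition = trim_decomposition W "P_tilde P" I X
  for W :: "'a topology" and P I and X :: "pt \<Rightarrow> 'a set" +
  assumes zigzag: "zigzag P"
begin

text \<open>The point \<open>\<bottom>\<close> lies below everything, so its piece belongs to the closure of each non-empty
  union of pieces; the finite/cofinite dichotomy decides on which side of a complement it falls.\<close>

definition ext :: "pt set \<Rightarrow> pt set"
  where "ext S = (if finite S then S else insert Bot S)"

definition realize :: "pt set \<Rightarrow> 'a set"
  where "realize S = (\<Union>p\<in>ext S. X p)"

lemmas P_tilde = P_tilde_zigzag[OF zigzag] and Bot_notin = Bot_notin_zigzag[OF zigzag]

lemma ext_subset: "S \<subseteq> P \<Longrightarrow> ext S \<subseteq> P_tilde P"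
  using finite_subset by (auto simp: ext_def P_tilde)

lemma ext_inj: "S \<subseteq> P \<Longrightarrow> T \<subseteq> P \<Longrightarrow> ext S = ext T \<Longrightarrow> S = T"
  using Bot_notin insert_ident[of Bot S T] unfolding ext_def by (auto split: if_splits)

lemma ext_Un: "ext (S \<union> T) = ext S \<union> ext T"
  by (auto simp: ext_def)

text \<open>Two infinite members of \<open>fincofin P\<close> are cofinite, so their intersection is
  infinite and keeps \<open>Bot\<close>; for arbitrary infinite sets this fails.\<close>

lemma ext_Int:
  assumes "S \<in> fincofin P" "T \<in> fincofin P"
  shows "ext (S \<inter> T) = ext S \<inter> ext T"
proof (cases "finite S \<or> finite T")
  case True
  then show ?thesis using assms Bot_notin by (auto simp: ext_def fincofin_def)
next
  case False
  then have "finite (P - T)" "infinite S" "S \<subseteq> P" using assms by (auto simp: fincofin_def)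
  moreover have "S \<subseteq> (S \<inter> T) \<union> (P - T)" using \<open>S \<subseteq> P\<close> by blast
  ultimately have "infinite (S \<inter> T)" by (meson finite_UnI finite_subset)
  then show ?thesis using False by (simp add: ext_def)
qed

text \<open>For infinite \<open>P\<close> exactly one of \<open>S\<close> and \<open>P - S\<close>
  is infinite, so exactly one of them receives \<open>Bot\<close>.\<close>

lemma ext_compl:
  assumes "S \<in> fincofin P"
  shows "ext (P - S) = P_tilde P - ext S"
proof -
  have S: "S \<subseteq> P" "finite S \<or> finite (P - S)" using assms by (auto simp: fincofin_def)
  have "Bot \<notin> S" using S(1) Bot_notin by blast
  show ?thesis
  proof (cases "finite P")
    case True
    then have "finite S" using S(1) finite_subset by blast
    with True show ?thesis by (simp add: ext_def P_tilde)
  next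
    case False
    then have *: "finite S \<longleftrightarrow> infinite (P - S)"
      using S Diff_infinite_finite[of S P] finite_Un[of "P - S" S] by (auto simp: Un_absorb2)
    show ?thesis
    proof (cases "finite S")
      case True
      then have "ext (P - S) = insert Bot (P - S)" "ext S = S" using * by (simp_all add: ext_def)
      then show ?thesis using False \<open>Bot \<notin> S\<close> by (simp add: P_tilde insert_Diff_if)
    next
      case False
      then have "ext (P - S) = P - S" "ext S = insert Bot S" using * by (simp_all add: ext_def)
      then show ?thesis using \<open>infinite P\<close> Bot_notin by (auto simp: P_tilde)
    qed
  qed
qed

text \<open>In an infinite \<open>P\<close> the down-set of a non-empty \<open>S\<close> is
  cofinite, hence infinite, and \<open>ext\<close> adds \<open>Bot\<close> just as the order of
  \<open>P_tilde P\<close> does.\<close>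

lemma ext_down:
  assumes "S \<subseteq> P"
  shows "ext (down P S) = down (P_tilde P) (ext S)"
proof (cases "S = {} \<or> finite P")
  case True
  then show ?thesis
  proof
    assume "S = {}" then show ?thesis by (simp add: ext_def down_def)
  next
    assume "finite P"
    then have "finite S" "finite (down P S)" using assms finite_subset down_subset by blast+
    then show ?thesis using \<open>finite P\<close> by (simp add: ext_def P_tilde)
  qed
next
  case False
  have "P \<subseteq> down P S \<union> (P - down P S)" by blast
  then have "infinite (down P S)"
    using down_cofinite[OF zigzag assms] False by (meson finite_UnI finite_subset)
  moreover have "down (insert Bot P) (ext S) = insert Bot (down P S)"
  proof (intro equalityI subsetI)
    fix p assume "p \<in> down (insert Bot P) (ext S)"
    then obtain q where q: "p \<in> insert Bot P" "q \<in> ext S" "p \<le> q" by (auto simp: down_def)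
    show "p \<in> insert Bot (down P S)"
    proof (cases p)
      case (Pt k)
      then have "q \<noteq> Bot" using q(3) by auto
      then show ?thesis using q Pt by (auto simp: ext_def down_def split: if_splits)
    qed simp
  next
    fix p assume "p \<in> insert Bot (down P S)"
    then show "p \<in> down (insert Bot P) (ext S)" using False by (auto simp: ext_def down_def)
  qed
  ultimately show ?thesis using False by (simp add: ext_def[of "down P S"] P_tilde)
qed

lemma X_UN_inj:
  assumes "S \<subseteq> P_tilde P" "T \<subseteq> P_tilde P" "(\<Union>p\<in>S. X p) \<subseteq> (\<Union>p\<in>T. X p)"
  shows "S \<subseteq> T"
proof
  fix p assume p: "p \<in> S"
  then obtain x where x: "x \<in> X p" using X_nonempty assms(1) by blast
  then obtain q where "q \<in> T" "x \<in> X q" using assms(3) p by blast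
  with x p show "p \<in> T" using X_unique[of p q x] assms(1,2) by blast
qed

lemma
  assumes S: "S \<subseteq> P_tilde P" and T: "T \<subseteq> P_tilde P"
  shows X_UN_Diff: "(\<Union>p\<in>S - T. X p) = (\<Union>p\<in>S. X p) - (\<Union>p\<in>T. X p)"
    and X_UN_Int: "(\<Union>p\<in>S \<inter> T. X p) = (\<Union>p\<in>S. X p) \<inter> (\<Union>p\<in>T. X p)"
proof -
  have eq: "p = q" if "p \<in> S" "q \<in> T" "x \<in> X p" "x \<in> X q" for p q x
    by (rule X_unique[OF subsetD[OF S that(1)] subsetD[OF T that(2)] that(3,4)])
  show "(\<Union>p\<in>S - T. X p) = (\<Union>p\<in>S. X p) - (\<Union>p\<in>T. X p)"
    "(\<Union>p\<in>S \<inter> T. X p) = (\<Union>p\<in>S. X p) \<inter> (\<Union>p\<in>T. X p)"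
    by (auto dest: eq)
qed

lemma realize_inj: "inj_on realize (fincofin P)"
proof (rule inj_onI)
  fix S T assume "S \<in> fincofin P" "T \<in> fincofin P" and eq: "realize S = realize T"
  then have ST: "S \<subseteq> P" "T \<subseteq> P" using fincofinD by blast+
  have "ext S = ext T"
    using X_UN_inj[OF ext_subset[OF ST(1)] ext_subset[OF ST(2)]]
      X_UN_inj[OF ext_subset[OF ST(2)] ext_subset[OF ST(1)]] eq
    unfolding realize_def by blast
  then show "S = T" by (rule ext_inj[OF ST])
qed

lemma realize_iso:
  "closure_algebra_iso P (down P) (fincofin P) (topspace W) ((closure_of) W) (realize ` fincofin P) realize"
  unfolding closure_algebra_iso_def
proof (intro conjI ballI)
  show "bij_betw realize (fincofin P) (realize ` fincofin P)"
    using realize_inj by (simp add: bij_betw_def)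
  fix S assume S: "S \<in> fincofin P"
  note SP = fincofinD[OF S]
  show "realize (P - S) = topspace W - realize S"
  proof -
    have "topspace W = (\<Union>p\<in>P_tilde P. X p)" using complete by (simp add: complete_partition_def)
    then show ?thesis
      unfolding realize_def ext_compl[OF S] using X_UN_Diff[OF order.refl ext_subset[OF SP]] by simp
  qed
  show "realize (down P S) = W closure_of realize S"
    unfolding realize_def ext_down[OF SP] closure_X_Union[OF ext_subset[OF SP]] ..
  fix T assume T: "T \<in> fincofin P"
  show "realize (S \<union> T) = realize S \<union> realize T" by (simp add: realize_def ext_Un)
  show "realize (S \<inter> T) = realize S \<inter> realize T"
    unfolding realize_def ext_Int[OF S T]
    by (rule X_UN_Int[OF ext_subset[OF SP] ext_subset[OF fincofinD[OF T]]])
qed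

lemma realize_single: "realize {p} = X p"
  by (simp add: realize_def ext_def)

text \<open>\<open>Pt 0\<close> is maximal, so a trim neighbourhood of one of its points stays
  inside its piece.\<close>

lemma X_0_open: "openin W (X (Pt 0))"
proof (subst openin_subopen, intro ballI)
  fix x assume x: "x \<in> X (Pt 0)"
  have 0: "Pt 0 \<in> P_tilde P" using Pt_0_in_zigzag[OF zigzag] by (simp add: P_tilde)
  then have "x \<in> topspace W" using x X_subset by blast
  then obtain N where N: "clopenin W N" "x \<in> N" "type_set (P_tilde P) X N = {q \<in> P_tilde P. Pt 0 \<le> q}"
    using base[OF 0 x openin_topspace] by blast
  have "N \<subseteq> X (Pt 0)"
  proof
    fix y assume y: "y \<in> N"
    then obtain q where q: "q \<in> P_tilde P" "y \<in> X q" using openin_X_cover N(1) by blast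
    then have "Pt 0 \<le> q" using type_setI[OF q(1) y q(2)] N(3) by blast
    then have "q = Pt 0" by (cases q) auto
    with q show "y \<in> X (Pt 0)" by simp
  qed
  with N show "\<exists>T. openin W T \<and> x \<in> T \<and> T \<subseteq> X (Pt 0)" by blast
qed

text \<open>One inclusion holds because the image of \<open>realize\<close> is a closure subalgebra;
  for the other, the generated algebra is pulled back to \<open>P\<close>, where
  \<open>{Pt 0}\<close> generates everything.\<close>

lemma open_generated_X_0: "open_generated W (X (Pt 0)) = realize ` fincofin P"
proof
  note fc = closure_subalgebra_fincofin[OF zigzag]
  have 0: "{Pt 0} \<in> fincofin P" using Pt_0_in_zigzag[OF zigzag] by (intro fincofin_finite) auto
  show "open_generated W (X (Pt 0)) \<subseteq> realize ` fincofin P"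
    unfolding open_generated_def
  proof (rule generated_subalgebra_minimal)
    show "{X (Pt 0)} \<subseteq> realize ` fincofin P" using 0 realize_single by blast
  qed (rule iso_image[OF realize_iso fc order.refl])
  let ?K = "{S \<in> fincofin P. realize S \<in> open_generated W (X (Pt 0))}"
  have "closure_subalgebra (topspace W) ((closure_of) W) (open_generated W (X (Pt 0)))"
    unfolding open_generated_def
    using openin_subset[OF X_0_open]
    by (intro closure_subalgebra_generated closure_algebra_Pow_topspace) auto
  then have "closure_subalgebra P (down P) ?K" by (rule iso_preimage[OF realize_iso fc])
  moreover have "X (Pt 0) \<in> open_generated W (X (Pt 0))"
    unfolding open_generated_def generated_subalgebra_def using hull_subset by fast
  then have "{Pt 0} \<in> ?K" using 0 by (simp add: realize_single)
  ultimately have "fincofin P \<subseteq> ?K" by (rule fincofin_generated[OF zigzag])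
  then show "realize ` fincofin P \<subseteq> open_generated W (X (Pt 0))" by blast
qed

lemma realize_mono_iff:
  assumes "S \<in> fincofin P" "T \<in> fincofin P"
  shows "realize S \<subseteq> realize T \<longleftrightarrow> S \<subseteq> T"
proof -
  have "S \<union> T \<in> fincofin P"
    by (rule closure_subalgebraD(3)[OF closure_subalgebra_fincofin[OF zigzag] assms])
  then have "realize (S \<union> T) = realize T \<longleftrightarrow> S \<union> T = T"
    using inj_on_eq_iff[OF realize_inj _ assms(2)] by blast
  moreover have "realize (S \<union> T) = realize S \<union> realize T" by (simp add: realize_def ext_Un)
  ultimately show ?thesis by (simp add: subset_Un_eq)
qed

lemma atoms: "{B. atom_of (realize ` fincofin P) B} = X ` P"
proof (intro equalityI subsetI; (elim CollectE imageE)?)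
  have empty: "realize {} = {}" by (simp add: realize_def ext_def)
  have single: "{p} \<in> fincofin P" if "p \<in> P" for p using that by (simp add: fincofin_finite)
  fix B
  show "B \<in> X ` P" if B: "atom_of (realize ` fincofin P) B"
  proof -
    obtain S where S: "S \<in> fincofin P" "B = realize S" "B \<noteq> {}"
      using B by (auto simp: atom_of_def)
    then have "S \<noteq> {}" using empty by auto
    then obtain p where p: "p \<in> S" by blast
    have pP: "p \<in> P" using p fincofinD[OF S(1)] by blast
    have "X p \<subseteq> B"
      using realize_mono_iff[OF single[OF pP] S(1)] p by (simp add: realize_single S(2))
    moreover have "X p \<in> realize ` fincofin P"
      using single[OF pP] realize_single by blast
    moreover have "X p \<noteq> {}" using X_nonempty[of p] pP by (simp add: P_tilde)
    ultimately have "X p = B" using B unfolding atom_of_def by blast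
    then show ?thesis using pP by blast
  qed
  fix p assume p: "B = X p" "p \<in> P"
  show "B \<in> {B. atom_of (realize ` fincofin P) B}"
    unfolding atom_of_def
  proof (intro CollectI conjI ballI impI)
    show "B \<in> realize ` fincofin P" using single[OF p(2)] realize_single p(1) by blast
    show "B \<noteq> {}" using X_nonempty[of p] p by (simp add: P_tilde)
    fix C assume C: "C \<in> realize ` fincofin P" "C \<subseteq> B"
    then obtain S where S: "S \<in> fincofin P" "C = realize S" by blast
    then have "S \<subseteq> {p}" using realize_mono_iff[OF S(1) single[OF p(2)]] C(2) p(1) realize_single by simp
    then show "C = {} \<or> C = B" using S(2) empty realize_single p(1) by (auto simp: subset_singleton_iff)
  qed
qed

text \<open>The atoms are the pieces with index in \<open>P\<close>, so what they leave uncovered is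
  the piece of \<open>Bot\<close>.\<close>

lemma atom_family_X:
  assumes "p \<in> P_tilde P"
  shows "X p = atom_family W (X (Pt 0)) realize p"
proof (cases "p = Bot")
  case True
  then have "P_tilde P = insert Bot P" using assms Bot_notin by (auto simp: P_tilde split: if_splits)
  moreover have "A_infty W (X (Pt 0)) = topspace W - (\<Union>p\<in>P. X p)"
    by (simp add: A_infty_def open_generated_X_0 atoms)
  moreover have "topspace W = (\<Union>p\<in>P_tilde P. X p)" using complete by (simp add: complete_partition_def)
  ultimately have "A_infty W (X (Pt 0)) = X Bot"
    using X_UN_Diff[of "P_tilde P" P] Bot_notin by (simp add: insert_Diff_if subset_insertI)
  then show ?thesis using True by (simp add: atom_family_def bot_pt_def)
next
  case False
  then show ?thesis by (simp add: atom_family_def bot_pt_def realize_single)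
qed

theorem generates: "generates_trim_partition W P I (X (Pt 0))"
proof -
  interpret F: trim_decomposition W "P_tilde P" I "atom_family W (X (Pt 0)) realize"
    by (rule trim_decomposition_cong[OF trim_decomposition_axioms atom_family_X])
  show ?thesis
    unfolding generates_trim_partition_def
    using X_0_open realize_iso F.complete F.trim_partition F.isolated
    by (auto simp: \<E>_zigzag[OF zigzag] open_generated_X_0)
qed

end

section \<open>Existence and uniqueness\<close>

text \<open>Going strictly up from some \<open>Pt k\<close> lowers the index, so the least index
  that occurs is final.\<close>

lemma mono_pt_eventually_constant:
  fixes l :: "nat \<Rightarrow> pt"
  assumes "mono l"
  shows "\<exists>N. \<forall>n\<ge>N. l n = l N"
proof (cases "\<exists>k N. l N = Pt k")
  case True
  define k where "k = (LEAST k. \<exists>N. l N = Pt k)"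
  obtain N where N: "l N = Pt k" unfolding k_def using LeastI_ex[OF True] by blast
  have "l n = l N" if n: "n \<ge> N" for n
  proof -
    have le: "Pt k \<le> l n" using monoD[OF assms n] N by simp
    then obtain j where j: "l n = Pt j" by (cases "l n") auto
    then have "k \<le> j" unfolding k_def by (intro Least_le) blast
    then show ?thesis using le j N by auto
  qed
  then show ?thesis by blast
next
  case False
  then have "l n = Bot" for n by (cases "l n") auto
  then show ?thesis by simp
qed

lemma zigzag_walk:
  assumes P: "zigzag P" and I: "I \<subseteq> P_tilde P - maximal_elements (P_tilde P)"
  obtains a b e where "poset_walk (P_tilde P) I a b e"
proof -
  have countable: "countable (P_tilde P)"
    using countable_subset[OF zigzag_subset[OF P]] by (simp add: P_tilde_zigzag[OF P])
  have I_less: "\<exists>q\<in>P_tilde P. p < q" if "p \<in> I" for p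
    using that I by (auto simp: maximal_elements_def)
  have "\<exists>a b. a \<in> P_tilde P \<and> b \<in> P_tilde P \<and> (\<forall>q\<in>P_tilde P. a \<le> q \<or> b \<le> q) \<and>
      (\<forall>p. p \<in> minimal_elements (P_tilde P) \<longrightarrow> p \<in> I \<longrightarrow> (a = p \<longleftrightarrow> b \<noteq> p))"
    using P
  proof (cases rule: zigzag_cases)
    case inf
    then have "P_tilde P = insert Bot (range Pt)" by (simp add: P_tilde_def P_inf_def bot_pt_def)
    \<comment> \<open>\<open>Bot\<close> alone generates; the second start only has to differ from
      it, so that the minimal piece is reached by one choice of the first bit.\<close>
    then show ?thesis
      by (intro exI[of _ Bot] exI[of _ "Pt 0"]) (auto simp: minimal_elements_def)
  next
    case (initial m)
    then have T: "P_tilde P = Pt ` {..m}" using P_tilde_zigzag[OF P] by simp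
    \<comment> \<open>The minimal elements are \<open>Pt m\<close> and \<open>Pt (m - 1)\<close>.
      For \<open>m = 0\<close> truncated subtraction makes the two starts coincide, but a
      \<open>p \<in> I\<close> has an element above it, which forces an index of at least 2.\<close>
    have "Pt m = p \<longleftrightarrow> Pt (m - 1) \<noteq> p" if p: "p \<in> minimal_elements (P_tilde P)" "p \<in> I" for p
    proof -
      obtain j where j: "p = Pt j" "j \<le> m" using p(1) by (auto simp: minimal_elements_def T)
      have "\<not> Pt m < Pt j" using p(1) j by (auto simp: minimal_elements_def T)
      moreover obtain i where "i + 2 \<le> j" using I_less[OF p(2)] j(1) T by auto
      ultimately show ?thesis using j by auto
    qed
    then show ?thesis
      by (intro exI[of _ "Pt m"] exI[of _ "Pt (m - 1)"]) (auto simp: T)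
  next
    case (gap m)
    then have T: "P_tilde P = insert (Pt (m + 2)) (Pt ` {..m})" using P_tilde_zigzag[OF P] by simp
    have "p = Pt (m + 2)" if p: "p \<in> minimal_elements (P_tilde P)" for p
      using p by (auto simp: minimal_elements_def T)
    then show ?thesis
      by (intro exI[of _ "Pt (m + 2)"] exI[of _ "Pt 0"]) (auto simp: T)
  qed
  then obtain a b where ab: "a \<in> P_tilde P" "b \<in> P_tilde P" "\<forall>q\<in>P_tilde P. a \<le> q \<or> b \<le> q"
      "\<forall>p. p \<in> minimal_elements (P_tilde P) \<longrightarrow> p \<in> I \<longrightarrow> (a = p \<longleftrightarrow> b \<noteq> p)" by blast
  show thesis
  proof (rule poset_walk_exists[of "P_tilde P" I a b])
    show "\<exists>N. \<forall>n\<ge>N. l n = l N" if "mono l" for l :: "nat \<Rightarrow> pt"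
      by (rule mono_pt_eventually_constant[OF that])
  qed (use countable I_less ab that in blast)+
qed

text \<open>The case \<open>U = {p\<^sub>1}\<close> occurs only if \<open>P = P(1, n)\<close>; then exchanging \<open>p\<^sub>0\<close> and \<open>p\<^sub>1\<close> is an
  automorphism of \<open>P\<close>.\<close>

lemma generated_trim_decomposition:
  assumes P: "zigzag P" and I: "I \<subseteq> P_tilde P - maximal_elements (P_tilde P)"
    and W: "compact_space W" "Hausdorff_space W"
    and B: "generates_trim_partition W P I B" "B \<noteq> {}"
  obtains Y where "trim_decomposition W (P_tilde P) I Y" "Y (Pt 0) = B"
proof -
  obtain \<phi> where B_open: "openin W B"
    and iso: "closure_algebra_iso P (down P) (fincofin P) (topspace W) ((closure_of) W) (open_generated W B) \<phi>"
    and Y: "complete_partition W (P_tilde P) (atom_family W B \<phi>)"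
      "trim_partition W (P_tilde P) (atom_family W B \<phi>)"
      "isolated_partition W (P_tilde P) I (atom_family W B \<phi>)"
    using B(1) unfolding generates_trim_partition_def \<E>_zigzag[OF P] by blast
  let ?Y = "atom_family W B \<phi>"
  interpret Y: trim_decomposition W "P_tilde P" I ?Y
    by (rule trim_decompositionI[OF W Y])
  note fc = closure_subalgebra_fincofin[OF P]
  have bij: "bij_betw \<phi> (fincofin P) (open_generated W B)"
    and compl: "\<And>S. S \<in> fincofin P \<Longrightarrow> \<phi> (P - S) = topspace W - \<phi> S"
    and closure: "\<And>S. S \<in> fincofin P \<Longrightarrow> \<phi> (down P S) = W closure_of \<phi> S"
    using iso by (simp_all add: closure_algebra_iso_def)
  have inj: "inj_on \<phi> (fincofin P)" using bij by (rule bij_betw_imp_inj_on)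
  have B_gen: "B \<in> open_generated W B"
    unfolding open_generated_def generated_subalgebra_def using hull_subset by fast
  then obtain U where U: "U \<in> fincofin P" "\<phi> U = B"
    unfolding bij_betw_imp_surj_on[OF bij, symmetric] by blast
  have compl_U: "P - U \<in> fincofin P" by (rule closure_subalgebraD(2)[OF fc U(1)])
  \<comment> \<open>Openness of \<open>B\<close> becomes closedness of \<open>P - U\<close> in the
    order, that is, \<open>U\<close> is an upper set.\<close>
  have "W closure_of (topspace W - B) = topspace W - B"
    using B_open by (intro closure_of_closedin) blast
  then have "\<phi> (down P (P - U)) = \<phi> (P - U)"
    using closure[OF compl_U] compl[OF U(1)] U(2) by simp
  then have upper: "down P (P - U) = P - U"
    using inj_onD[OF inj _ closure_subalgebraD(4)[OF fc compl_U] compl_U] by blast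
  have "U \<noteq> {}"
  proof
    assume "U = {}"
    then have "\<phi> P = topspace W - \<phi> {}" using compl[OF U(1)] by simp
    moreover have P_fc: "P \<in> fincofin P" "{} \<in> fincofin P" by (auto simp: fincofin_def)
    moreover have "\<phi> ({} \<inter> P) = \<phi> {} \<inter> \<phi> P"
      using iso P_fc unfolding closure_algebra_iso_def by blast
    ultimately have "\<phi> {} = {}" by auto
    with \<open>U = {}\<close> U(2) B(2) show False by simp
  qed
  \<comment> \<open>The image of \<open>K\<close> is a closure subalgebra containing
    \<open>B\<close>, hence everything that \<open>B\<close> generates; injectivity brings
    \<open>{Pt 0}\<close> back into \<open>K\<close>.\<close>
  have gen: "{Pt 0} \<in> K" if K: "closure_subalgebra P (down P) K" "K \<subseteq> fincofin P" "U \<in> K" for K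
  proof -
    have "open_generated W B \<subseteq> \<phi> ` K"
      unfolding open_generated_def
      by (rule generated_subalgebra_minimal) (use K(3) U(2) iso_image[OF iso K(1,2)] in auto)
    moreover have 0: "{Pt 0} \<in> fincofin P" using Pt_0_in_zigzag[OF P] by (simp add: fincofin_finite)
    then have "\<phi> {Pt 0} \<in> open_generated W B" by (rule bij_betw_apply[OF bij])
    ultimately obtain S where S: "S \<in> K" "\<phi> {Pt 0} = \<phi> S" by blast
    moreover from S have "S \<in> fincofin P" using K(2) by blast
    ultimately have "{Pt 0} = S" using inj_onD[OF inj S(2) 0] by blast
    with S show ?thesis by simp
  qed
  have Y_Pt: "?Y (Pt k) = \<phi> {Pt k}" for k by (simp add: atom_family_def bot_pt_def)
  from generating_upper_set[OF P U(1) \<open>U \<noteq> {}\<close> upper gen]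
  consider "U = {Pt 0}" | "U = {Pt 1}" "Pt 2 \<notin> P" by blast
  then show thesis
  proof cases
    case 1
    show thesis
      by (rule that[OF Y.trim_decomposition_axioms]) (use Y_Pt[of 0] U(2) 1 in simp)
  next
    case 2
    have P1: "Pt 1 \<in> P" using fincofinD[OF U(1)] 2(1) by simp
    obtain PT: "P_tilde P = P" "P = {Pt 0, Pt 1} \<or> P = {Pt 0, Pt 1, Pt 3}"
    proof -
      have "P = {Pt 0, Pt 1} \<or> P = {Pt 0, Pt 1, Pt 3}"
        using P
      proof (cases rule: zigzag_cases)
        case (initial m)
        then have "m = 1" using P1 2(2) by auto
        then show ?thesis using initial by (auto simp: atMost_Suc)
      next
        case (gap m)
        then have "m = 1" using P1 2(2) by auto
        then show ?thesis using gap by (auto simp: atMost_Suc numeral_eq_Suc)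
      qed (use 2(2) in auto)
      moreover from this have "finite P" by auto
      ultimately show thesis using that by (simp add: P_tilde_zigzag[OF P])
    qed
    define \<sigma> where "\<sigma> p = (if p = Pt 0 then Pt 1 else if p = Pt 1 then Pt 0 else p)" for p
    have "trim_decomposition W (P_tilde P) I (\<lambda>p. ?Y (\<sigma> p))"
    proof (rule Y.reindex)
      show "bij_betw \<sigma> (P_tilde P) (P_tilde P)"
      proof -
        have "\<sigma> ` P_tilde P \<subseteq> P_tilde P" unfolding PT(1) using PT(2) by (auto simp: \<sigma>_def)
        then show ?thesis by (intro bij_betw_byWitness[where f' = \<sigma>]) (simp_all add: \<sigma>_def)
      qed
      show "\<sigma> p \<le> \<sigma> q \<longleftrightarrow> p \<le> q" if "p \<in> P_tilde P" "q \<in> P_tilde P" for p q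
      proof -
        have "p \<in> {Pt 0, Pt 1, Pt 3}" "q \<in> {Pt 0, Pt 1, Pt 3}" using that PT by auto
        then show ?thesis by (elim insertE emptyE) (simp_all add: \<sigma>_def)
      qed
      \<comment> \<open>Both exchanged elements are maximal in these small posets and so lie outside
        \<open>I\<close>.\<close>
      have "Pt 0 \<notin> I" "Pt 1 \<notin> I"
        using I PT by (auto simp: maximal_elements_def)
      then show "\<sigma> p \<in> I \<longleftrightarrow> p \<in> I" if "p \<in> P_tilde P" for p
        by (simp add: \<sigma>_def)
    qed
    moreover have "?Y (\<sigma> (Pt 0)) = B" using Y_Pt[of 1] U(2) 2(1) by (simp add: \<sigma>_def)
    ultimately show thesis by (rule that)
  qed
qed

text \<open>Non-emptiness is required for the sake of uniqueness: over the one-element poset the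
  empty set and the whole space generate the same algebra, but no homeomorphism exchanges
  them.\<close>

theorem theorem7p3:
  fixes W :: "'a topology" and P I :: "pt set"
  assumes "W homeomorphic_space cantor_space"
    and "P = P_inf \<or> (\<exists>(m, n) \<in> J. P = P_fin m n)"
    and "I \<subseteq> P_tilde P - maximal_elements (P_tilde P)"
  shows "\<exists>A. A \<noteq> {} \<and> generates_trim_partition W P I A \<and>
           (\<forall>B. B \<noteq> {} \<and> generates_trim_partition W P I B \<longrightarrow>
              (\<exists>h. homeomorphic_map W W h \<and> h ` A = B))"
proof -
  have P: "zigzag P" using assms(2) by (simp add: zigzag_def)
  obtain f where f: "homeomorphic_map W cantor_space f"
    using assms(1) homeomorphic_space by blast
  obtain a b e where "poset_walk (P_tilde P) I a b e"
    using zigzag_walk[OF P assms(3)] by blast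
  then interpret walk: cantor_walk W f "P_tilde P" I a b e
    by (intro cantor_walk.intro cantor_coordinates.intro f)
  interpret zigzag_decomposition W P I walk.piece
    by unfold_locales (rule P)
  have 0: "Pt 0 \<in> P_tilde P" using Pt_0_in_zigzag[OF P] by (simp add: P_tilde)
  show ?thesis
  proof (intro exI[of _ "walk.piece (Pt 0)"] conjI allI impI)
    show "walk.piece (Pt 0) \<noteq> {}" by (rule walk.X_nonempty[OF 0])
    show "generates_trim_partition W P I (walk.piece (Pt 0))" by (rule generates)
    fix B assume "B \<noteq> {} \<and> generates_trim_partition W P I B"
    then obtain Y where Y: "trim_decomposition W (P_tilde P) I Y" "Y (Pt 0) = B"
      using generated_trim_decomposition[OF P assms(3) walk.compact walk.Hausdorff] by blast
    have "I \<subseteq> P_tilde P" using assms(3) by blast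
    from trim_decomposition_homeomorphism[OF walk.trim_decomposition_axioms Y(1) this walk.separating walk.separating]
    obtain h where "homeomorphic_map W W h" "\<And>p. p \<in> P_tilde P \<Longrightarrow> h ` walk.piece p = Y p"
      by blast
    then show "\<exists>h. homeomorphic_map W W h \<and> h ` walk.piece (Pt 0) = B"
      using 0 Y(2) by blast
  qed
qed

end
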